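(* Let $n\ge1$, let $\mathcal{E}$ be a Hilbert space, and let $L\in\mathcal{B}(\mathcal{E},\mathcal{F}_n^2\otimes\mathcal{E})$ be a symbol with odometer map $W_L\in\mathcal{B}(\mathcal{F}_n^2\otimes\mathcal{E})$. Let $W_{22}:=P_{\mathcal{M}^\perp}W_L|_{\mathcal{N}^\perp}:\mathcal{N}^\perp\to\mathcal{M}^\perp$. For $r\ge0$ let $L_r\in\mathcal{B}(\mathcal{E})$ be defined by $L_r:=(\langle e_1^r,\cdot\rangle\otimes I_{\mathcal{E}})L$. Then $$U_1W_{22}U_n^*=M_\Theta\quad\text{on }H^2_{\mathcal{E}}(\mathbb{D}),$$ where $M_\Theta$ is the analytic Toeplitz operator with uniquely determined symbol $\Theta\in H^\infty_{\mathcal{B}(\mathcal{E})}(\mathbb{D})$ given by $$\Theta(z)=\sum_{r\ge0}z^rL_r.$$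
   Context: Hilbert spaces are separable and complex; $\mathcal{B}(\mathcal{H},\mathcal{K})$ denotes bounded linear operators; $P_{\mathcal{S}}$ is the orthogonal projection onto a closed subspace $\mathcal{S}$. $F_n^+$ is the free monoid of words $\mu=\mu_1\cdots\mu_m$ in the letters $1,\dots,n$, with empty word $\emptyset$ and length $|\mu|$. The full Fock space $\mathcal{F}_n^2=\mathbb{C}\Omega\oplus\bigoplus_{k\ge1}(\mathbb{C}^n)^{\otimes k}$ has orthonormal basis $e_\mu=e_{\mu_1}\otimes\cdots\otimes e_{\mu_m}$, $\mu\in F_n^+$, with $e_\emptyset=\Omega$; $e_k^m:=e_k^{\otimes m}$, $e_k^0=\Omega$, and $\Omega$ acts as a unit for left tensoring. For $f\in\mathcal{F}_n^2\otimes\mathcal{E}$, $e_1^p\otimes f$ means left tensoring by $e_1^p$. Odometer map: for $L\in\mathcal{B}(\mathcal{E},\mathcal{F}_n^2\otimes\mathcal{E})$, $W_L$ is the operator on $\mathcal{F}_n^2\otimes\mathcal{E}$ given by $W_L(\Omega\otimes\eta)=L\eta$; $W_L(e_n^m\otimes\eta)=e_1^m\otimes L\eta$ for $m\ge1$; and, for a nonempty word $\mu=\mu_1\cdots\mu_m$ having some letter $\ne n$, with $k$ the smallest index such that $\mu_k\neq n$, $W_L(e_\mu\otimes\eta)=e_1^{k-1}\otimes e_{\mu_k+1}\otimes e_{\mu_{k+1}}\otimes\cdots\otimes e_{\mu_m}\otimes\eta$. It is a standing assumption that $W_L$ is a bounded operator on $\mathcal{F}_n^2\otimes\mathcal{E}$.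 $\mathcal{M}$ (resp. $\mathcal{N}$) is the closed span of all $e_\mu\otimes\xi$, $\xi\in\mathcal{E}$, with $|\mu|\ge1$ and some letter $\mu_i\ne1$ (resp. some letter $\mu_i\neq n$). So $\mathcal{M}^\perp=\overline{\mathrm{span}}\{e_1^m\otimes\xi:m\ge0,\xi\in\mathcal{E}\}$ and $\mathcal{N}^\perp=\overline{\mathrm{span}}\{e_n^m\otimes\xi:m\ge0,\xi\in\mathcal{E}\}$. $U_1:\mathcal{M}^\perp\to H^2_{\mathcal{E}}(\mathbb{D})$ and $U_n:\mathcal{N}^\perp\to H^2_{\mathcal{E}}(\mathbb{D})$ are the unitaries determined by $U_1(e_1^p\otimes\eta)=z^p\eta=U_n(e_n^p\otimes\eta)$ for $p\ge0$, $\eta\in\mathcal{E}$. The operator $\langle e_1^r,\cdot\rangle\otimes I_{\mathcal{E}}:\mathcal{F}_n^2\otimes\mathcal{E}\to\mathcal{E}$ sends $e_\mu\otimes\eta$ to $\eta$ if $e_\mu=e_1^r$ and to $0$ otherwise. $H^2_{\mathcal{E}}(\mathbb{D})$ is the $\mathcal{E}$-valued Hardy space on the unit disc, $H^\infty_{\mathcal{B}(\mathcal{E})}(\mathbb{D})$ the bounded analytic $\mathcal{B}(\mathcal{E})$-valued functions, and $M_\Theta f(z)=\Theta(z)f(z)$. *)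

theory Defs
  imports "HOL-Complex_Analysis.Cauchy_Integral_Formula"
begin

section \<open>Complex Hilbert spaces\<close>

text \<open>
  A complex Hilbert space is a complete real inner product space carrying a complex scalar
  multiplication and a complex inner product, conjugate-linear in the first and linear in the
  second argument, whose real part is the given real inner product.  The norm, the topology and
  completeness are therefore those of the library classes.
\<close>

class chilbert_space = real_inner + banach +
  fixes scaleC :: "complex \<Rightarrow> 'a \<Rightarrow> 'a"  (infixr \<open>*\<^sub>C\<close> 75)
    and cinner :: "'a \<Rightarrow> 'a \<Rightarrow> complex"
  assumes scaleC_add_right: "c *\<^sub>C (x + y) = c *\<^sub>C x + c *\<^sub>C y"
    and scaleC_add_left: "(c + d) *\<^sub>C x = c *\<^sub>C x + d *\<^sub>C x"
    and scaleC_scaleC: "c *\<^sub>C d *\<^sub>C x = (c * d) *\<^sub>C x"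
    and scaleR_scaleC: "r *\<^sub>R x = complex_of_real r *\<^sub>C x"
    and cinner_commute: "cinner x y = cnj (cinner y x)"
    and cinner_add_right: "cinner x (y + z) = cinner x y + cinner x z"
    and cinner_scaleC_right: "cinner x (c *\<^sub>C y) = c * cinner x y"
    and inner_eq_Re_cinner: "inner x y = Re (cinner x y)"

lemma scaleC_one [simp]: "1 *\<^sub>C (x::'a::chilbert_space) = x"
  using scaleR_scaleC[of 1 x] by simp

global_interpretation cvec: vector_space "scaleC :: complex \<Rightarrow> 'a \<Rightarrow> 'a::chilbert_space"
  defines csubspace = cvec.subspace and cspan = cvec.span
  by standard (simp_all add: scaleC_add_right scaleC_add_left scaleC_scaleC)

lemma cinner_add_left: "cinner (x + y) z = cinner x z + cinner y (z::'a::chilbert_space)"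
  by (metis cinner_commute cinner_add_right complex_cnj_add)

lemma cinner_scaleC_left: "cinner (c *\<^sub>C x) y = cnj c * cinner x (y::'a::chilbert_space)"
  by (metis cinner_commute cinner_scaleC_right complex_cnj_mult)

lemma cinner_zero [simp]: "cinner x 0 = 0" "cinner 0 x = 0" for x :: "'a::chilbert_space"
  using cinner_add_right[of x 0 0] cinner_add_left[of 0 0 x] by simp_all

lemma cinner_diff_right: "cinner x (y - z) = cinner x y - cinner x (z::'a::chilbert_space)"
  using cinner_add_right[of x "y - z" z] by simp

lemma cinner_self: "cinner x x = complex_of_real ((norm (x::'a::chilbert_space))\<^sup>2)"
proof (rule complex_eqI)
  show "Re (cinner x x) = Re (complex_of_real ((norm x)\<^sup>2))"
    by (simp add: inner_eq_Re_cinner[symmetric] power2_norm_eq_inner)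
  show "Im (cinner x x) = Im (complex_of_real ((norm x)\<^sup>2))"
    using arg_cong[OF cinner_commute[of x x], of Im] by simp
qed

lemma norm_scaleC [simp]: "norm (c *\<^sub>C x) = cmod c * norm (x::'a::chilbert_space)"
proof -
  have "complex_of_real ((norm (c *\<^sub>C x))\<^sup>2) = (cnj c * c) * complex_of_real ((norm x)\<^sup>2)"
    by (simp only: cinner_self[symmetric] cinner_scaleC_left cinner_scaleC_right ac_simps)
  also have "\<dots> = complex_of_real ((cmod c * norm x)\<^sup>2)"
    by (simp add: complex_norm_square[symmetric] power_mult_distrib mult.commute[of "cnj c"])
  finally have "(norm (c *\<^sub>C x))\<^sup>2 = (cmod c * norm x)\<^sup>2"
    using of_real_eq_iff by blast
  then show ?thesis
    by (simp add: power2_eq_iff_nonneg)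
qed

lemma cmod_cinner_le: "cmod (cinner x y) \<le> norm x * norm (y::'a::chilbert_space)"
proof (cases "cinner x y = 0")
  case False
  define c where "c = cnj (sgn (cinner x y))"
  have c: "c * cinner x y = complex_of_real (cmod (cinner x y))"
    using False by (simp add: c_def sgn_eq complex_norm_square[symmetric] power2_eq_square mult.commute[of "cnj _"])
  have "cmod (cinner x y) = inner x (c *\<^sub>C y)"
    by (simp add: inner_eq_Re_cinner cinner_scaleC_right c)
  also have "\<dots> \<le> norm x * norm (c *\<^sub>C y)"
    by (rule norm_cauchy_schwarz)
  also have "\<dots> = norm x * norm y"
    using False by (simp add: c_def norm_sgn)
  finally show ?thesis .
qed simp

lemma bounded_linear_cinner_right: "bounded_linear (cinner (x::'a::chilbert_space))"
  by (rule bounded_linear_intro[where K = "norm x"])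
    (simp_all add: cinner_add_right scaleR_scaleC cinner_scaleC_right cmod_cinner_le mult.commute[of _ "norm x"] scaleR_conv_of_real)

lemma bounded_linear_scaleC_right: "bounded_linear (\<lambda>x::'a::chilbert_space. c *\<^sub>C x)"
  by (rule bounded_linear_intro[where K = "cmod c"])
    (simp_all add: scaleC_add_right scaleR_scaleC scaleC_scaleC mult.commute)

instantiation complex :: chilbert_space
begin

definition "scaleC_complex = ((*) :: complex \<Rightarrow> complex \<Rightarrow> complex)"
definition "cinner_complex (x::complex) (y::complex) = cnj x * y"

instance
  by standard (simp_all add: scaleC_complex_def cinner_complex_def algebra_simps scaleR_conv_of_real inner_complex_def)

end

section \<open>Square-summable families\<close>

lemma square_summable_cinner:
  fixes f g :: "'i \<Rightarrow> 'a::chilbert_space"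
  assumes "(\<lambda>i. (norm (f i))\<^sup>2) summable_on UNIV" "(\<lambda>i. (norm (g i))\<^sup>2) summable_on UNIV"
  shows "(\<lambda>i. cinner (f i) (g i)) summable_on UNIV"
proof (rule abs_summable_summable, rule summable_on_comparison_test)
  show "(\<lambda>i. (norm (f i))\<^sup>2 + (norm (g i))\<^sup>2) summable_on UNIV"
    using assms by (rule summable_on_add)
  show "norm (cinner (f i) (g i)) \<le> (norm (f i))\<^sup>2 + (norm (g i))\<^sup>2" for i
    using cmod_cinner_le[of "f i" "g i"] sum_squares_bound[of "norm (f i)" "norm (g i)"]
      mult_nonneg_nonneg[OF norm_ge_zero norm_ge_zero, of "f i" "g i"]
    by linarith
qed auto

lemma square_summable_add:
  fixes f g :: "'i \<Rightarrow> 'a::real_normed_vector"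
  assumes "(\<lambda>i. (norm (f i))\<^sup>2) summable_on UNIV" "(\<lambda>i. (norm (g i))\<^sup>2) summable_on UNIV"
  shows "(\<lambda>i. (norm (f i + g i))\<^sup>2) summable_on UNIV"
proof (rule summable_on_comparison_test)
  show "(\<lambda>i. 2 * (norm (f i))\<^sup>2 + 2 * (norm (g i))\<^sup>2) summable_on UNIV"
    using assms by (intro summable_on_add summable_on_cmult_right)
  show "(norm (f i + g i))\<^sup>2 \<le> 2 * (norm (f i))\<^sup>2 + 2 * (norm (g i))\<^sup>2" for i
  proof -
    have "(norm (f i + g i))\<^sup>2 \<le> (norm (f i) + norm (g i))\<^sup>2"
      by (intro power_mono norm_triangle_ineq) simp
    then show ?thesis
      using sum_squares_bound[of "norm (f i)" "norm (g i)"] by (simp add: power2_sum)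
  qed
qed simp

lemma square_summable_scaleC:
  fixes f :: "'i \<Rightarrow> 'a::chilbert_space"
  assumes "(\<lambda>i. (norm (f i))\<^sup>2) summable_on UNIV"
  shows "(\<lambda>i. (norm (c *\<^sub>C f i))\<^sup>2) summable_on UNIV"
  using assms by (simp add: power_mult_distrib summable_on_cmult_right)

text \<open>
  The type \<open>('i, 'a) ell2\<close> is the Hilbert space of square-summable \<open>'a\<close>-valued families indexed
  by \<open>'i\<close>.  It is the standard model of the Hilbert space tensor product of the scalar space
  \<open>('i, complex) ell2\<close> with \<open>'a\<close>; see \<open>tens\<close> below.
\<close>

typedef (overloaded) ('i, 'a::chilbert_space) ell2 =
  "{f :: 'i \<Rightarrow> 'a. (\<lambda>i. (norm (f i))\<^sup>2) summable_on UNIV}"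
  morphisms coord Abs_ell2
  by (rule exI[of _ "\<lambda>_. 0"]) simp

setup_lifting type_definition_ell2

lemma square_summable_coord: "(\<lambda>i. (norm (coord x i))\<^sup>2) summable_on UNIV"
  using coord by auto

lemma ell2_eqI: "(\<And>i. coord x i = coord y i) \<Longrightarrow> x = y"
  by (simp add: coord_inject[symmetric] ext)

instantiation ell2 :: (type, chilbert_space) real_inner
begin

lift_definition zero_ell2 :: "('a, 'b) ell2" is "\<lambda>_. 0" by simp
lift_definition plus_ell2 :: "('a, 'b) ell2 \<Rightarrow> ('a, 'b) ell2 \<Rightarrow> ('a, 'b) ell2"
  is "\<lambda>f g i. f i + g i" by (rule square_summable_add)
lift_definition uminus_ell2 :: "('a, 'b) ell2 \<Rightarrow> ('a, 'b) ell2" is "\<lambda>f i. - f i" by simp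
lift_definition minus_ell2 :: "('a, 'b) ell2 \<Rightarrow> ('a, 'b) ell2 \<Rightarrow> ('a, 'b) ell2"
  is "\<lambda>f g i. f i - g i"
  using square_summable_add[of _ "\<lambda>i. - _ i"] by fastforce
lift_definition scaleR_ell2 :: "real \<Rightarrow> ('a, 'b) ell2 \<Rightarrow> ('a, 'b) ell2"
  is "\<lambda>r f i. r *\<^sub>R f i" by (simp only: scaleR_scaleC square_summable_scaleC)

definition inner_ell2 :: "('a, 'b) ell2 \<Rightarrow> ('a, 'b) ell2 \<Rightarrow> real"
  where "inner_ell2 x y = (\<Sum>\<^sub>\<infinity>i. inner (coord x i) (coord y i))"
definition norm_ell2 :: "('a, 'b) ell2 \<Rightarrow> real"
  where "norm_ell2 x = sqrt (inner x x)"
definition dist_ell2 :: "('a, 'b) ell2 \<Rightarrow> ('a, 'b) ell2 \<Rightarrow> real"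
  where "dist_ell2 x y = norm (x - y)"
definition sgn_ell2 :: "('a, 'b) ell2 \<Rightarrow> ('a, 'b) ell2"
  where "sgn_ell2 x = inverse (norm x) *\<^sub>R x"
definition uniformity_ell2 :: "(('a, 'b) ell2 \<times> ('a, 'b) ell2) filter"
  where "uniformity_ell2 = (INF e\<in>{0<..}. principal {(x, y). dist x y < e})"
definition open_ell2 :: "('a, 'b) ell2 set \<Rightarrow> bool"
  where "open_ell2 U \<longleftrightarrow> (\<forall>x\<in>U. eventually (\<lambda>(x', y). x' = x \<longrightarrow> y \<in> U) uniformity)"

lemma summable_inner_coord:
  "(\<lambda>i. inner (coord x i) (coord (y :: ('a, 'b) ell2) i)) summable_on UNIV"
  unfolding inner_eq_Re_cinner
  by (intro summable_on_Re square_summable_cinner square_summable_coord)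

instance
proof
  fix x y z :: "('a, 'b) ell2" and r s :: real and U :: "('a, 'b) ell2 set"
  show "x + y + z = x + (y + z)" by transfer (simp add: add.assoc)
  show "x + y = y + x" by transfer (simp add: add.commute)
  show "0 + x = x" by transfer simp
  show "- x + x = 0" by transfer simp
  show "x - y = x + - y" by transfer simp
  show "r *\<^sub>R (x + y) = r *\<^sub>R x + r *\<^sub>R y" by transfer (simp add: scaleR_add_right)
  show "(r + s) *\<^sub>R x = r *\<^sub>R x + s *\<^sub>R x" by transfer (simp add: scaleR_add_left)
  show "r *\<^sub>R s *\<^sub>R x = (r * s) *\<^sub>R x" by transfer simp
  show "1 *\<^sub>R x = x" by transfer simp
  show "dist x y = norm (x - y)" by (fact dist_ell2_def)
  show "sgn x = inverse (norm x) *\<^sub>R x" by (fact sgn_ell2_def)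
  show "uniformity = (INF e\<in>{0<..}. principal {(x :: ('a, 'b) ell2, y). dist x y < e})"
    by (fact uniformity_ell2_def)
  show "open U = (\<forall>x\<in>U. eventually (\<lambda>(x', y). x' = x \<longrightarrow> y \<in> U) uniformity)"
    by (fact open_ell2_def)
  show "inner x y = inner y x" by (simp add: inner_ell2_def inner_commute)
  show "inner (x + y) z = inner x z + inner y z"
    by (simp add: inner_ell2_def plus_ell2.rep_eq inner_add_left infsum_add summable_inner_coord)
  show "inner (r *\<^sub>R x) y = r * inner x y"
    by (simp add: inner_ell2_def scaleR_ell2.rep_eq infsum_cmult_right')
  show "0 \<le> inner x x" by (simp add: inner_ell2_def infsum_nonneg)
  show "norm x = sqrt (inner x x)" by (fact norm_ell2_def)
  show "inner x x = 0 \<longleftrightarrow> x = 0"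
  proof
    assume "inner x x = 0"
    then have "inner (coord x i) (coord x i) = 0" for i
      using nonneg_infsum_le_0D[of "\<lambda>i. inner (coord x i) (coord x i)" UNIV i]
        summable_inner_coord[of x x] by (simp add: inner_ell2_def)
    then show "x = 0" by (intro ell2_eqI) (simp add: zero_ell2.rep_eq)
  qed (simp add: inner_ell2_def zero_ell2.rep_eq)
qed

end

lemma norm_ell2_sq: "(norm x)\<^sup>2 = (\<Sum>\<^sub>\<infinity>i. (norm (coord x i))\<^sup>2)"
  by (simp add: norm_eq_sqrt_inner[of x] inner_ell2_def power2_norm_eq_inner infsum_nonneg)

lemma sum_coord_le_norm: "finite F \<Longrightarrow> (\<Sum>i\<in>F. (norm (coord x i))\<^sup>2) \<le> (norm x)\<^sup>2"
  unfolding norm_ell2_sq by (rule finite_sum_le_infsum) (auto simp: square_summable_coord)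

lemma norm_coord_le: "norm (coord x i) \<le> norm x"
  using sum_coord_le_norm[of "{i}" x] by (simp add: power2_le_iff_abs_le)

instance ell2 :: (type, chilbert_space) banach
proof
  fix X :: "nat \<Rightarrow> ('a, 'b) ell2"
  assume X: "Cauchy X"
  have coord_diff: "coord (x - y) i = coord x i - coord y i" for x y :: "('a, 'b) ell2" and i
    by (simp add: minus_ell2.rep_eq)
  have "Cauchy (\<lambda>n. coord (X n) i)" for i
    using X norm_coord_le[of "_ - _" i] unfolding Cauchy_def dist_norm coord_diff[symmetric]
    by (meson le_less_trans)
  then have "\<exists>l. (\<lambda>n. coord (X n) i) \<longlonglongrightarrow> l" for i
    using Cauchy_convergent convergent_def by blast
  then obtain g where g: "\<And>i. (\<lambda>n. coord (X n) i) \<longlonglongrightarrow> g i" by metis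
  have bound: "(\<Sum>i\<in>F. (norm (coord (X n) i - g i))\<^sup>2) \<le> e\<^sup>2"
    if "finite F" "\<forall>m\<ge>N. \<forall>n\<ge>N. norm (X m - X n) < e" "n \<ge> N" for F N n e
  proof (rule LIMSEQ_le_const2)
    show "(\<lambda>m. \<Sum>i\<in>F. (norm (coord (X n) i - coord (X m) i))\<^sup>2)
        \<longlonglongrightarrow> (\<Sum>i\<in>F. (norm (coord (X n) i - g i))\<^sup>2)"
      by (intro tendsto_intros g)
    show "\<exists>N. \<forall>m\<ge>N. (\<Sum>i\<in>F. (norm (coord (X n) i - coord (X m) i))\<^sup>2) \<le> e\<^sup>2"
    proof (intro exI allI impI)
      fix m assume "N \<le> m"
      then have "norm (X n - X m) < e" using that by blast
      then have "(norm (X n - X m))\<^sup>2 \<le> e\<^sup>2" by (intro power_mono) auto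
      then show "(\<Sum>i\<in>F. (norm (coord (X n) i - coord (X m) i))\<^sup>2) \<le> e\<^sup>2"
        using sum_coord_le_norm[OF that(1), of "X n - X m"] unfolding coord_diff by linarith
    qed
  qed
  have summ: "(\<lambda>i. (norm (coord (X n) i - g i))\<^sup>2) summable_on UNIV"
    if "\<forall>m\<ge>N. \<forall>n\<ge>N. norm (X m - X n) < e" "n \<ge> N" for N n e
    by (rule nonneg_bdd_above_summable_on)
      (use bound[OF _ that] in \<open>auto intro!: bdd_aboveI2[where M = "e\<^sup>2"]\<close>)
  have Cau: "\<exists>N. \<forall>m\<ge>N. \<forall>n\<ge>N. norm (X m - X n) < e" if "e > 0" for e
    using X that unfolding Cauchy_def dist_norm by blast
  obtain N1 where N1: "\<forall>m\<ge>N1. \<forall>n\<ge>N1. norm (X m - X n) < 1" using Cau[of 1] by auto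
  have "(\<lambda>i. (norm (coord (X N1) i + - (coord (X N1) i - g i)))\<^sup>2) summable_on UNIV"
    by (rule square_summable_add)
      (use square_summable_coord summ[OF N1 order_refl] in \<open>simp_all add: norm_minus_commute\<close>)
  then have coord_g: "coord (Abs_ell2 g) = g" by (simp add: Abs_ell2_inverse)
  have "X \<longlonglongrightarrow> Abs_ell2 g"
  proof (rule LIMSEQ_I)
    fix r :: real assume "0 < r"
    then obtain N where N: "\<forall>m\<ge>N. \<forall>n\<ge>N. norm (X m - X n) < r / 2" using Cau[of "r / 2"] by auto
    show "\<exists>no. \<forall>n\<ge>no. norm (X n - Abs_ell2 g) < r"
    proof (intro exI allI impI)
      fix n assume n: "N \<le> n"
      have "(norm (X n - Abs_ell2 g))\<^sup>2 \<le> (r / 2)\<^sup>2"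
        unfolding norm_ell2_sq coord_diff coord_g
        by (rule infsum_le_finite_sums[OF summ[OF N n] bound[OF _ N n]])
      then have "norm (X n - Abs_ell2 g) \<le> r / 2"
        using \<open>0 < r\<close> by (simp add: power2_le_iff_abs_le)
      then show "norm (X n - Abs_ell2 g) < r" using \<open>0 < r\<close> by simp
    qed
  qed
  then show "convergent X" by (auto simp: convergent_def)
qed

instantiation ell2 :: (type, chilbert_space) chilbert_space
begin

lift_definition scaleC_ell2 :: "complex \<Rightarrow> ('a, 'b) ell2 \<Rightarrow> ('a, 'b) ell2"
  is "\<lambda>c f i. c *\<^sub>C f i" by (rule square_summable_scaleC)

definition cinner_ell2 :: "('a, 'b) ell2 \<Rightarrow> ('a, 'b) ell2 \<Rightarrow> complex"
  where "cinner_ell2 x y = (\<Sum>\<^sub>\<infinity>i. cinner (coord x i) (coord y i))"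

instance
proof
  fix x y z :: "('a, 'b) ell2" and c d :: complex and r :: real
  have summ: "(\<lambda>i. cinner (coord x i) (coord y i)) summable_on UNIV" for x y :: "('a, 'b) ell2"
    by (intro square_summable_cinner square_summable_coord)
  show "c *\<^sub>C (x + y) = c *\<^sub>C x + c *\<^sub>C y" by transfer (simp add: scaleC_add_right)
  show "(c + d) *\<^sub>C x = c *\<^sub>C x + d *\<^sub>C x" by transfer (simp add: scaleC_add_left)
  show "c *\<^sub>C d *\<^sub>C x = (c * d) *\<^sub>C x" by transfer (simp add: scaleC_scaleC)
  show "r *\<^sub>R x = complex_of_real r *\<^sub>C x" by transfer (simp add: scaleR_scaleC)
  show "cinner x y = cnj (cinner y x)"
    unfolding cinner_ell2_def infsum_cnj[symmetric] by (simp add: cinner_commute[symmetric])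
  show "cinner x (y + z) = cinner x y + cinner x z"
    by (simp add: cinner_ell2_def plus_ell2.rep_eq cinner_add_right infsum_add summ)
  show "cinner x (c *\<^sub>C y) = c * cinner x y"
    by (simp add: cinner_ell2_def scaleC_ell2.rep_eq cinner_scaleC_right infsum_cmult_right')
  show "inner x y = Re (cinner x y)"
    by (simp add: cinner_ell2_def inner_ell2_def inner_eq_Re_cinner infsum_Re summ)
qed

end

text \<open>
  The elementary tensor \<open>f \<otimes> \<eta>\<close> and the basis vectors \<open>e\<^sub>i\<close>.  The lemmas
  \<open>cinner_tens\<close> and \<open>closure_cspan_tens\<close> show that \<open>('i, 'a) ell2\<close>, together with \<open>tens\<close>,
  is the Hilbert space tensor product of \<open>('i, complex) ell2\<close> and \<open>'a\<close>.
\<close>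

lift_definition tens :: "('i, complex) ell2 \<Rightarrow> 'a::chilbert_space \<Rightarrow> ('i, 'a) ell2"
  is "\<lambda>f \<eta> i. f i *\<^sub>C \<eta>"
  by (simp add: power_mult_distrib summable_on_cmult_left)

lift_definition ket :: "'i \<Rightarrow> ('i, complex) ell2" is "\<lambda>i j. if j = i then 1 else 0"
  by (rule finite_nonzero_values_imp_summable_on, rule finite_subset[of _ "{_}"]) auto

lemma coord_tens_ket: "coord (tens (ket i) \<eta>) j = (if j = i then \<eta> else 0)"
  by (simp add: tens.rep_eq ket.rep_eq)

lemma cinner_tens: "cinner (tens f \<eta>) (tens g \<zeta>) = cinner f g * cinner \<eta> \<zeta>"
  by (simp add: cinner_ell2_def tens.rep_eq cinner_scaleC_left cinner_scaleC_right
      cinner_complex_def ac_simps infsum_cmult_right')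

lemma cinner_tens_ket: "cinner (tens (ket i) \<eta>) x = cinner \<eta> (coord x i)"
proof -
  have "cinner (tens (ket i) \<eta>) x = (\<Sum>\<^sub>\<infinity>j\<in>{i}. cinner (coord (tens (ket i) \<eta>) j) (coord x j))"
    unfolding cinner_ell2_def by (rule infsum_cong_neutral) (auto simp: coord_tens_ket)
  then show ?thesis by (simp add: coord_tens_ket)
qed

lemma closure_cspan_tens:
  fixes I :: "'i set"
  shows "closure (cspan {tens (ket i) (\<eta>::'a::chilbert_space) | i \<eta>. i \<in> I})
    = {x. \<forall>i. i \<notin> I \<longrightarrow> coord x i = 0}"
  (is "closure (cspan ?S) = ?R")
proof
  have "csubspace ?R"
    by (auto simp: cvec.subspace_def zero_ell2.rep_eq plus_ell2.rep_eq scaleC_ell2.rep_eq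
        cvec.scale_zero_right)
  then have "cspan ?S \<subseteq> ?R"
    by (intro cvec.span_minimal) (auto simp: coord_tens_ket)
  moreover have "closed ?R"
  proof -
    have "bounded_linear (\<lambda>x::('i, 'a) ell2. coord x i)" for i
      by (rule bounded_linear_intro[where K = 1])
        (simp_all add: plus_ell2.rep_eq scaleR_ell2.rep_eq norm_coord_le)
    then have "closed {x::('i, 'a) ell2. coord x i = 0}" for i
      by (intro closed_Collect_eq continuous_on_const linear_continuous_on)
    then have "closed (\<Inter>i\<in>- I. {x::('i, 'a) ell2. coord x i = 0})" by blast
    also have "(\<Inter>i\<in>- I. {x. coord x i = 0}) = ?R" by auto
    finally show ?thesis .
  qed
  ultimately show "closure (cspan ?S) \<subseteq> ?R" by (rule closure_minimal)
  show "?R \<subseteq> closure (cspan ?S)"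
  proof
    fix x :: "('i, 'a) ell2" assume x: "x \<in> ?R"
    show "x \<in> closure (cspan ?S)"
      unfolding closure_approachable
    proof (intro allI impI)
      fix e :: real assume e: "e > 0"
      have "((\<lambda>i. (norm (coord x i))\<^sup>2) has_sum (norm x)\<^sup>2) UNIV"
        by (simp add: norm_ell2_sq has_sum_infsum square_summable_coord)
      then obtain F where F: "finite F" "dist (\<Sum>i\<in>F. (norm (coord x i))\<^sup>2) ((norm x)\<^sup>2) \<le> e\<^sup>2 / 4"
        using has_sum_finite_approximation[of _ _ _ "e\<^sup>2 / 4"] e by (metis zero_less_divide_iff zero_less_numeral zero_less_power)
      define y where "y = (\<Sum>i\<in>F \<inter> I. tens (ket i) (coord x i))"
      have y: "y \<in> cspan ?S"
        unfolding y_def by (intro cvec.span_sum cvec.span_base) auto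
      have coord_sum: "coord (\<Sum>i\<in>G. f i) j = (\<Sum>i\<in>G. coord (f i) j)" for G :: "'i set" and f :: "'i \<Rightarrow> ('i, 'a) ell2" and j
        by (induction G rule: infinite_finite_induct) (simp_all add: zero_ell2.rep_eq plus_ell2.rep_eq)
      have cy: "coord y j = (if j \<in> F then coord x j else 0)" for j
        using x F(1) by (auto simp: y_def coord_sum coord_tens_ket)
      have split: "(\<Sum>\<^sub>\<infinity>i. (norm (coord x i))\<^sup>2)
          = (\<Sum>i\<in>F. (norm (coord x i))\<^sup>2) + (\<Sum>\<^sub>\<infinity>i\<in>-F. (norm (coord x i))\<^sup>2)"
        using infsum_Un_disjoint[of "\<lambda>i. (norm (coord x i))\<^sup>2" F "- F"] F(1)
        by (simp add: summable_on_subset[OF square_summable_coord])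
      have "(norm (y - x))\<^sup>2 = (\<Sum>\<^sub>\<infinity>i\<in>-F. (norm (coord x i))\<^sup>2)"
        unfolding norm_ell2_sq by (rule infsum_cong_neutral) (auto simp: minus_ell2.rep_eq cy)
      also have "\<dots> \<le> e\<^sup>2 / 4"
        using F(2) split by (simp add: norm_ell2_sq dist_real_def)
      also have "\<dots> < e\<^sup>2" using e by simp
      finally show "\<exists>y\<in>cspan ?S. dist y x < e"
        using y e by (auto simp: dist_norm power2_less_imp_less intro!: bexI[of _ y])
    qed
  qed
qed

section \<open>Operators between closed subspaces\<close>

text \<open>
  Operators with domain a closed subspace \<open>A\<close> are functions on the ambient type of which only the
  values on \<open>A\<close> matter.
\<close>

definition bounded_clinear_on ::
  "'a::chilbert_space set \<Rightarrow> 'b::chilbert_space set \<Rightarrow> ('a \<Rightarrow> 'b) \<Rightarrow> bool"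
  where "bounded_clinear_on A B T \<longleftrightarrow>
    T ` A \<subseteq> B \<and>
    (\<forall>x\<in>A. \<forall>y\<in>A. T (x + y) = T x + T y) \<and>
    (\<forall>c. \<forall>x\<in>A. T (c *\<^sub>C x) = c *\<^sub>C T x) \<and>
    (\<exists>K. \<forall>x\<in>A. norm (T x) \<le> K * norm x)"

definition unitary_on ::
  "'a::chilbert_space set \<Rightarrow> 'b::chilbert_space set \<Rightarrow> ('a \<Rightarrow> 'b) \<Rightarrow> bool"
  where "unitary_on A B U \<longleftrightarrow>
    bounded_clinear_on A B U \<and> U ` A = B \<and> (\<forall>x\<in>A. \<forall>y\<in>A. cinner (U x) (U y) = cinner x y)"

definition adjoint_on ::
  "'a::chilbert_space set \<Rightarrow> ('a \<Rightarrow> 'b::chilbert_space) \<Rightarrow> 'b \<Rightarrow> 'a"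
  where "adjoint_on A T y = (THE x. x \<in> A \<and> (\<forall>a\<in>A. cinner (T a) y = cinner a x))"

definition orth_proj :: "'a::chilbert_space set \<Rightarrow> 'a \<Rightarrow> 'a"
  where "orth_proj S x = (THE y. y \<in> S \<and> (\<forall>s\<in>S. cinner s (x - y) = 0))"

definition orth_complement_in :: "'a::chilbert_space set \<Rightarrow> 'a set \<Rightarrow> 'a set"
  where "orth_complement_in H S = {x \<in> H. \<forall>s\<in>S. cinner s x = 0}"

section \<open>The full Fock space\<close>

text \<open>The free monoid on the letters \<open>1, \<dots>, n\<close>; the product is list concatenation.\<close>

definition free_monoid :: "nat \<Rightarrow> nat list set"
  where "free_monoid n = lists {1..n}"

text \<open>
  \<open>fock n\<close> consists of the square-summable families indexed by the free monoid (extended by zero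
  to all words).  At scalar type it is the full Fock space with orthonormal basis \<open>ket \<mu>\<close>
  (and vacuum \<open>ket []\<close>); at type \<open>'a\<close> it is the tensor product of the full Fock space with \<open>'a\<close>,
  with \<open>e\<^sub>\<mu> \<otimes> \<eta> = tens (ket \<mu>) \<eta>\<close>.
\<close>

definition fock :: "nat \<Rightarrow> (nat list, 'a::chilbert_space) ell2 set"
  where "fock n = {x. \<forall>\<mu>. \<mu> \<notin> free_monoid n \<longrightarrow> coord x \<mu> = 0}"

text \<open>Left tensoring by the basis vector of the word \<open>\<alpha>\<close>.\<close>

lift_definition left_tensor ::
  "nat list \<Rightarrow> (nat list, 'a::chilbert_space) ell2 \<Rightarrow> (nat list, 'a) ell2"
  is "\<lambda>\<alpha> x \<mu>. if take (length \<alpha>) \<mu> = \<alpha> then x (drop (length \<alpha>) \<mu>) else 0"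
proof -
  fix \<alpha> :: "nat list" and x :: "nat list \<Rightarrow> 'a"
  assume "(\<lambda>\<mu>. (norm (x \<mu>))\<^sup>2) summable_on UNIV"
  then have "(\<lambda>\<mu>. (norm (x (drop (length \<alpha>) \<mu>)))\<^sup>2) summable_on range ((@) \<alpha>)"
    by (subst summable_on_reindex) (auto simp: o_def inj_on_def)
  then show "(\<lambda>\<mu>. (norm (if take (length \<alpha>) \<mu> = \<alpha> then x (drop (length \<alpha>) \<mu>) else 0))\<^sup>2)
      summable_on UNIV"
    by (subst summable_on_cong_neutral[where T = "range ((@) \<alpha>)"])
      (auto simp: image_iff, metis append_take_drop_id)
qed

lemma left_tensor_tens_ket: "left_tensor \<alpha> (tens (ket \<mu>) \<eta>) = tens (ket (\<alpha> @ \<mu>)) \<eta>"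
  by (rule ell2_eqI)
    (auto simp: left_tensor.rep_eq coord_tens_ket, metis append_take_drop_id)

text \<open>\<open>\<langle>f, \<cdot>\<rangle> \<otimes> I\<close>\<close>

definition bra_tensor_id :: "('i, complex) ell2 \<Rightarrow> ('i, 'a::chilbert_space) ell2 \<Rightarrow> 'a"
  where "bra_tensor_id f x = (\<Sum>\<^sub>\<infinity>i. cnj (coord f i) *\<^sub>C coord x i)"

lemma bra_tensor_id_ket: "bra_tensor_id (ket i) x = coord x i"
proof -
  have "bra_tensor_id (ket i) x = (\<Sum>\<^sub>\<infinity>j\<in>{i}. cnj (coord (ket i) j) *\<^sub>C coord x j)"
    unfolding bra_tensor_id_def
    by (rule infsum_cong_neutral) (auto simp: ket.rep_eq cvec.scale_zero_left)
  then show ?thesis by (simp add: ket.rep_eq)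
qed

text \<open>
  The closed span of all \<open>e\<^sub>\<mu> \<otimes> \<xi>\<close> where \<open>\<mu>\<close> has some letter different from \<open>a\<close>.  The spaces
  usually denoted \<open>\<M>\<close> and \<open>\<N>\<close> are the cases \<open>a = 1\<close> and \<open>a = n\<close>.
\<close>

definition off_axis :: "nat \<Rightarrow> nat \<Rightarrow> (nat list, 'a::chilbert_space) ell2 set"
  where "off_axis n a = closure (cspan {tens (ket \<mu>) \<xi> | \<mu> \<xi>.
    \<mu> \<in> free_monoid n \<and> 1 \<le> length \<mu> \<and> (\<exists>i<length \<mu>. \<mu> ! i \<noteq> a)})"

definition M_perp :: "nat \<Rightarrow> (nat list, 'a::chilbert_space) ell2 set"
  where "M_perp n = orth_complement_in (fock n) (off_axis n 1)"

definition N_perp :: "nat \<Rightarrow> (nat list, 'a::chilbert_space) ell2 set"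
  where "N_perp n = orth_complement_in (fock n) (off_axis n n)"

lemma axis_coord:
  assumes "a \<in> {1..n}"
  shows "orth_complement_in (fock n) (off_axis n a)
    = {x::(nat list, 'a::chilbert_space) ell2. \<forall>\<mu>. \<mu> \<notin> range (\<lambda>p. replicate p a) \<longrightarrow> coord x \<mu> = 0}"
    (is "?L = ?R")
proof -
  let ?I = "{\<mu>. \<mu> \<in> free_monoid n \<and> 1 \<le> length \<mu> \<and> (\<exists>i<length \<mu>. \<mu> ! i \<noteq> a)}"
  have repl: "\<mu> \<in> range (\<lambda>p. replicate p a) \<longleftrightarrow> \<mu> \<in> free_monoid n \<and> \<mu> \<notin> ?I" for \<mu>
  proof
    assume "\<mu> \<in> free_monoid n \<and> \<mu> \<notin> ?I"
    then have "\<forall>i<length \<mu>. \<mu> ! i = a" by (cases \<mu>) auto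
    then have "\<mu> = replicate (length \<mu>) a" by (simp add: list_eq_iff_nth_eq)
    then show "\<mu> \<in> range (\<lambda>p. replicate p a)" by blast
  next
    assume "\<mu> \<in> range (\<lambda>p. replicate p a)"
    then show "\<mu> \<in> free_monoid n \<and> \<mu> \<notin> ?I"
      using assms by (auto simp: free_monoid_def in_lists_conv_set)
  qed
  have off: "off_axis n a = {x::(nat list, 'a) ell2. \<forall>\<mu>. \<mu> \<notin> ?I \<longrightarrow> coord x \<mu> = 0}"
    unfolding off_axis_def using closure_cspan_tens[of ?I] by simp
  show ?thesis
  proof
    show "?L \<subseteq> ?R"
    proof
      fix x :: "(nat list, 'a) ell2" assume x: "x \<in> ?L"
      have "coord x \<mu> = 0" if "\<mu> \<in> ?I" for \<mu>
      proof -
        have "tens (ket \<mu>) (coord x \<mu>) \<in> off_axis n a"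
          using that by (auto simp: off coord_tens_ket)
        then have "cinner (tens (ket \<mu>) (coord x \<mu>)) x = 0"
          using x by (auto simp: orth_complement_in_def)
        then show ?thesis by (simp add: cinner_tens_ket cinner_self)
      qed
      then show "x \<in> ?R" using x repl by (auto simp: orth_complement_in_def fock_def)
    qed
    show "?R \<subseteq> ?L"
    proof
      fix x :: "(nat list, 'a) ell2" assume x: "x \<in> ?R"
      have "cinner s x = 0" if "s \<in> off_axis n a" for s
        unfolding cinner_ell2_def
      proof (rule infsum_0)
        fix \<mu>
        show "cinner (coord s \<mu>) (coord x \<mu>) = 0"
          using that x repl[of \<mu>] unfolding off by (cases "\<mu> \<in> ?I") auto
      qed
      then show "x \<in> ?L" using x repl by (auto simp: orth_complement_in_def fock_def)
    qed
  qed
qed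

lemma axis_eq:
  assumes "a \<in> {1..n}"
  shows "orth_complement_in (fock n) (off_axis n a)
    = closure (cspan {tens (ket (replicate p a)) (\<xi>::'a::chilbert_space) | p \<xi>. True})"
proof -
  have "{tens (ket (replicate p a)) (\<xi>::'a) | p \<xi>. True}
      = {tens (ket i) \<xi> | i \<xi>. i \<in> range (\<lambda>p. replicate p a)}" by auto
  then show ?thesis
    by (simp only: axis_coord[OF assms] closure_cspan_tens)
qed

text \<open>
  \<open>W\<close> is the (bounded) odometer map of the symbol \<open>L\<close>.  List positions count from \<open>0\<close>, so the
  first letter different from \<open>n\<close> sits at the \<open>j\<close> with \<open>j = k - 1\<close> in the usual one-based notation.
\<close>

definition is_odometer_map ::
  "nat \<Rightarrow> ('a::chilbert_space \<Rightarrow> (nat list, 'a) ell2) \<Rightarrow>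
   ((nat list, 'a) ell2 \<Rightarrow> (nat list, 'a) ell2) \<Rightarrow> bool"
  where "is_odometer_map n L W \<longleftrightarrow>
    bounded_clinear_on (fock n) (fock n) W \<and>
    (\<forall>\<eta>. W (tens (ket []) \<eta>) = L \<eta>) \<and>
    (\<forall>m\<ge>1. \<forall>\<eta>. W (tens (ket (replicate m n)) \<eta>) = left_tensor (replicate m 1) (L \<eta>)) \<and>
    (\<forall>\<mu>\<in>free_monoid n. \<forall>\<eta>. (\<exists>i<length \<mu>. \<mu> ! i \<noteq> n) \<longrightarrow>
      (let j = (LEAST i. i < length \<mu> \<and> \<mu> ! i \<noteq> n) in
        W (tens (ket \<mu>) \<eta>)
          = tens (ket (replicate j 1 @ (\<mu> ! j + 1) # drop (j + 1) \<mu>)) \<eta>))"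

section \<open>The vector-valued Hardy space\<close>

definition power_series :: "(nat, 'a::chilbert_space) ell2 \<Rightarrow> complex \<Rightarrow> 'a"
  where "power_series a z = (if cmod z < 1 then \<Sum>k. z ^ k *\<^sub>C coord a k else 0)"

lemma power_series_summable:
  assumes "cmod z < 1"
  shows "summable (\<lambda>k. z ^ k *\<^sub>C coord (a :: (nat, 'a::chilbert_space) ell2) k)"
proof (rule summable_comparison_test')
  show "summable (\<lambda>k. cmod z ^ k * norm a)"
    using assms by (intro summable_mult2 summable_geometric) simp
  show "norm (z ^ k *\<^sub>C coord a k) \<le> cmod z ^ k * norm a" for k
    by (simp add: norm_power mult_left_mono norm_coord_le)
qed

lemma power_series_add: "power_series (a + b) z = power_series a z + power_series b z"
  by (simp add: power_series_def plus_ell2.rep_eq scaleC_add_right suminf_add power_series_summable)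

lemma power_series_scaleC: "power_series (c *\<^sub>C a) z = c *\<^sub>C power_series a z"
proof (cases "cmod z < 1")
  case True
  have "(\<Sum>k. c *\<^sub>C z ^ k *\<^sub>C coord a k) = c *\<^sub>C (\<Sum>k. z ^ k *\<^sub>C coord a k)"
    by (rule bounded_linear.suminf[OF bounded_linear_scaleC_right power_series_summable[OF True], symmetric])
  then show ?thesis
    using True by (simp add: power_series_def scaleC_ell2.rep_eq scaleC_scaleC mult.commute)
qed (simp add: power_series_def cvec.scale_zero_right)

lemma power_series_uminus: "power_series (- a) z = - power_series a z"
  using power_series_scaleC[of "- 1" a z] by (simp add: cvec.scale_minus_left)

lemma power_series_diff: "power_series (a - b) z = power_series a z - power_series b z"
  using power_series_add[of a "- b" z] by (simp add: power_series_uminus)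

lemma power_series_eq_0D:
  fixes a :: "(nat, 'a::chilbert_space) ell2"
  assumes "\<And>z. power_series a z = 0"
  shows "a = 0"
proof (rule ell2_eqI)
  fix k
  have sums: "(\<lambda>k. cinner x (coord a k) * z ^ k) sums 0" if "norm z < 1" for x z
  proof -
    have "(\<lambda>k. z ^ k *\<^sub>C coord a k) sums 0"
      using power_series_summable[OF that, of a] assms[of z] that
      by (simp add: power_series_def summable_sums_iff)
    from bounded_linear.sums[OF bounded_linear_cinner_right this, of x]
    show ?thesis by (simp add: cinner_scaleC_right mult.commute)
  qed
  have zero: "cinner x (coord a 0) = 0" for x
    using sums[of 0 x] powser_sums_zero_iff[of "\<lambda>k. cinner x (coord a k)" 0] by simp
  have "cinner x (coord a k) = 0" for x
  proof (rule ccontr)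
    assume nz: "cinner x (coord a k) \<noteq> 0"
    then have "k > 0" using zero by (cases k) auto
    then obtain s where "s > 0" "\<And>z::complex. z \<in> cball 0 s - {0} \<Longrightarrow> (0::complex) \<noteq> 0"
      using powser_0_nonzero[of 1 0 "\<lambda>k. cinner x (coord a k)" "\<lambda>_. 0" k] sums nz by auto
    then show False by (metis DiffI abs_of_pos dist_0_norm less_eq_real_def mem_cball norm_of_real of_real_eq_0_iff less_irrefl singletonD)
  qed
  from this[of "coord a k"] show "coord a k = coord 0 k"
    by (simp add: cinner_self zero_ell2.rep_eq)
qed

text \<open>
  \<open>'a hardy\<close> is the space of functions \<open>f(z) = \<Sum>\<^sub>k z\<^sup>k a\<^sub>k\<close> on the unit disc with square-summable
  coefficients, with pointwise vector space operations and \<open>\<langle>f, g\<rangle> = \<Sum>\<^sub>k \<langle>a\<^sub>k, b\<^sub>k\<rangle>\<close>.  As functions on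
  all of the complex plane its elements vanish off the disc.
\<close>

typedef (overloaded) 'a::chilbert_space hardy = "range (power_series :: (nat, 'a) ell2 \<Rightarrow> _)"
  morphisms hardy_fun Abs_hardy
  by blast

setup_lifting type_definition_hardy

definition hardy_coeffs :: "'a::chilbert_space hardy \<Rightarrow> (nat, 'a) ell2"
  where "hardy_coeffs f = (THE a. hardy_fun f = power_series a)"

definition hardy_of :: "(nat, 'a::chilbert_space) ell2 \<Rightarrow> 'a hardy"
  where "hardy_of a = Abs_hardy (power_series a)"

lemma hardy_fun_of: "hardy_fun (hardy_of a) = power_series a"
  by (simp add: hardy_of_def Abs_hardy_inverse)

lemma power_series_inj:
  assumes "power_series a = power_series b"
  shows "a = b"
  using power_series_eq_0D[of "a - b"] by (simp add: power_series_diff assms)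

lemma hardy_coeffs_of [simp]: "hardy_coeffs (hardy_of a) = a"
  unfolding hardy_coeffs_def hardy_fun_of by (rule the_equality) (auto dest: power_series_inj)

lemma hardy_of_coeffs [simp]: "hardy_of (hardy_coeffs f) = f"
proof -
  obtain a where "f = hardy_of a"
    by (metis Abs_hardy_cases hardy_of_def imageE)
  then show ?thesis by simp
qed

lemma hardy_fun_eq: "hardy_fun f = power_series (hardy_coeffs f)"
  using hardy_fun_of[of "hardy_coeffs f"] by simp

instantiation hardy :: (chilbert_space) real_inner
begin

lift_definition zero_hardy :: "'a hardy" is "\<lambda>_. 0"
  by (rule image_eqI[of _ _ 0]) (auto simp: power_series_def zero_ell2.rep_eq cvec.scale_zero_right)
lift_definition plus_hardy :: "'a hardy \<Rightarrow> 'a hardy \<Rightarrow> 'a hardy" is "\<lambda>f g z. f z + g z"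
  by (auto simp: power_series_add[symmetric])
lift_definition uminus_hardy :: "'a hardy \<Rightarrow> 'a hardy" is "\<lambda>f z. - f z"
  by (auto simp: power_series_uminus[symmetric])
lift_definition minus_hardy :: "'a hardy \<Rightarrow> 'a hardy \<Rightarrow> 'a hardy" is "\<lambda>f g z. f z - g z"
  by (auto simp: power_series_diff[symmetric])
lift_definition scaleR_hardy :: "real \<Rightarrow> 'a hardy \<Rightarrow> 'a hardy" is "\<lambda>r f z. r *\<^sub>R f z"
  by (auto simp: scaleR_scaleC power_series_scaleC[symmetric])

definition inner_hardy :: "'a hardy \<Rightarrow> 'a hardy \<Rightarrow> real"
  where "inner_hardy f g = inner (hardy_coeffs f) (hardy_coeffs g)"
definition norm_hardy :: "'a hardy \<Rightarrow> real"
  where "norm_hardy f = sqrt (inner f f)"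
definition dist_hardy :: "'a hardy \<Rightarrow> 'a hardy \<Rightarrow> real"
  where "dist_hardy f g = norm (f - g)"
definition sgn_hardy :: "'a hardy \<Rightarrow> 'a hardy"
  where "sgn_hardy f = inverse (norm f) *\<^sub>R f"
definition uniformity_hardy :: "('a hardy \<times> 'a hardy) filter"
  where "uniformity_hardy = (INF e\<in>{0<..}. principal {(x, y). dist x y < e})"
definition open_hardy :: "'a hardy set \<Rightarrow> bool"
  where "open_hardy U \<longleftrightarrow> (\<forall>x\<in>U. eventually (\<lambda>(x', y). x' = x \<longrightarrow> y \<in> U) uniformity)"

lemma hardy_coeffs_inject: "hardy_coeffs f = hardy_coeffs g \<longleftrightarrow> f = (g :: 'a hardy)"
  by (metis hardy_of_coeffs)

lemma hardy_coeffs_eqI: "(\<And>z. hardy_fun f z = power_series a z) \<Longrightarrow> hardy_coeffs f = a"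
  by (rule power_series_inj) (simp add: hardy_fun_eq ext)

lemma hardy_coeffs_zero: "hardy_coeffs (0 :: 'a hardy) = 0"
  by (rule hardy_coeffs_eqI)
    (simp add: zero_hardy.rep_eq power_series_def zero_ell2.rep_eq cvec.scale_zero_right)

lemma hardy_coeffs_add: "hardy_coeffs (f + g :: 'a hardy) = hardy_coeffs f + hardy_coeffs g"
  by (rule hardy_coeffs_eqI) (simp add: plus_hardy.rep_eq power_series_add flip: hardy_fun_eq)

lemma hardy_coeffs_uminus: "hardy_coeffs (- f :: 'a hardy) = - hardy_coeffs f"
  by (rule hardy_coeffs_eqI) (simp add: uminus_hardy.rep_eq power_series_uminus flip: hardy_fun_eq)

lemma hardy_coeffs_diff: "hardy_coeffs (f - g :: 'a hardy) = hardy_coeffs f - hardy_coeffs g"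
  by (rule hardy_coeffs_eqI) (simp add: minus_hardy.rep_eq power_series_diff flip: hardy_fun_eq)

lemma hardy_coeffs_scaleR: "hardy_coeffs (r *\<^sub>R f :: 'a hardy) = r *\<^sub>R hardy_coeffs f"
  by (rule hardy_coeffs_eqI)
    (simp add: scaleR_hardy.rep_eq scaleR_scaleC power_series_scaleC flip: hardy_fun_eq)

lemmas hardy_coeffs_simps =
  hardy_coeffs_zero hardy_coeffs_add hardy_coeffs_uminus hardy_coeffs_diff hardy_coeffs_scaleR

instance
proof
  fix x y z :: "'a hardy" and r s :: real and U :: "'a hardy set"
  note [simp] = hardy_coeffs_inject[symmetric] hardy_coeffs_simps inner_hardy_def
  show "x + y + z = x + (y + z)" by (simp add: add.assoc)
  show "x + y = y + x" by (simp add: add.commute)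
  show "0 + x = x" by simp
  show "- x + x = 0" by simp
  show "x - y = x + - y" by simp
  show "r *\<^sub>R (x + y) = r *\<^sub>R x + r *\<^sub>R y" by (simp add: scaleR_add_right)
  show "(r + s) *\<^sub>R x = r *\<^sub>R x + s *\<^sub>R x" by (simp add: scaleR_add_left)
  show "r *\<^sub>R s *\<^sub>R x = (r * s) *\<^sub>R x" by simp
  show "1 *\<^sub>R x = x" by simp
  show "dist x y = norm (x - y)" by (fact dist_hardy_def)
  show "sgn x = inverse (norm x) *\<^sub>R x" by (fact sgn_hardy_def)
  show "uniformity = (INF e\<in>{0<..}. principal {(x :: 'a hardy, y). dist x y < e})"
    by (fact uniformity_hardy_def)
  show "open U = (\<forall>x\<in>U. eventually (\<lambda>(x', y). x' = x \<longrightarrow> y \<in> U) uniformity)"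
    by (fact open_hardy_def)
  show "inner x y = inner y x" by (simp add: inner_commute)
  show "inner (x + y) z = inner x z + inner y z" by (simp add: inner_add_left)
  show "inner (r *\<^sub>R x) y = r * inner x y" by simp
  show "0 \<le> inner x x" by simp
  show "inner x x = 0 \<longleftrightarrow> x = 0" by simp
  show "norm x = sqrt (inner x x)" by (fact norm_hardy_def)
qed

end

lemma dist_hardy_coeffs: "dist (hardy_coeffs f) (hardy_coeffs g) = dist f g"
  by (simp add: dist_norm norm_eq_sqrt_inner inner_hardy_def hardy_coeffs_diff)

instance hardy :: (chilbert_space) banach
proof
  fix X :: "nat \<Rightarrow> 'a hardy"
  assume "Cauchy X"
  then have "Cauchy (\<lambda>n. hardy_coeffs (X n))"
    by (simp add: Cauchy_def dist_hardy_coeffs)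
  then obtain a where "(\<lambda>n. hardy_coeffs (X n)) \<longlonglongrightarrow> hardy_coeffs (hardy_of a)"
    using Cauchy_convergent convergent_def by (metis hardy_coeffs_of)
  then have "X \<longlonglongrightarrow> hardy_of a"
    by (simp only: tendsto_iff dist_hardy_coeffs)
  then show "convergent X" by (auto simp: convergent_def)
qed

instantiation hardy :: (chilbert_space) chilbert_space
begin

lift_definition scaleC_hardy :: "complex \<Rightarrow> 'a hardy \<Rightarrow> 'a hardy" is "\<lambda>c f z. c *\<^sub>C f z"
  by (auto simp: power_series_scaleC[symmetric])
definition cinner_hardy :: "'a hardy \<Rightarrow> 'a hardy \<Rightarrow> complex"
  where "cinner_hardy f g = cinner (hardy_coeffs f) (hardy_coeffs g)"

lemma hardy_coeffs_scaleC: "hardy_coeffs (c *\<^sub>C f :: 'a hardy) = c *\<^sub>C hardy_coeffs f"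
  by (rule hardy_coeffs_eqI) (simp add: scaleC_hardy.rep_eq power_series_scaleC flip: hardy_fun_eq)

instance
proof
  fix x y z :: "'a hardy" and c d :: complex and r :: real
  note [simp] = hardy_coeffs_inject[symmetric] hardy_coeffs_simps hardy_coeffs_scaleC
  show "c *\<^sub>C (x + y) = c *\<^sub>C x + c *\<^sub>C y" by (simp add: scaleC_add_right)
  show "(c + d) *\<^sub>C x = c *\<^sub>C x + d *\<^sub>C x" by (simp add: scaleC_add_left)
  show "c *\<^sub>C d *\<^sub>C x = (c * d) *\<^sub>C x" by (simp add: scaleC_scaleC)
  show "r *\<^sub>R x = complex_of_real r *\<^sub>C x" by (simp add: scaleR_scaleC)
  show "cinner x y = cnj (cinner y x)"
    unfolding cinner_hardy_def by (rule cinner_commute)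
  show "cinner x (y + z) = cinner x y + cinner x z" by (simp add: cinner_hardy_def cinner_add_right)
  show "cinner x (c *\<^sub>C y) = c * cinner x y" by (simp add: cinner_hardy_def cinner_scaleC_right)
  show "inner x y = Re (cinner x y)"
    by (simp add: inner_hardy_def cinner_hardy_def inner_eq_Re_cinner)
qed

end

text \<open>The unitaries with \<open>e\<^sub>a\<^sup>p \<otimes> \<eta> \<mapsto> z\<^sup>p \<eta>\<close>.\<close>

definition is_axis_unitary ::
  "nat \<Rightarrow> (nat list, 'a::chilbert_space) ell2 set \<Rightarrow> ((nat list, 'a) ell2 \<Rightarrow> 'a hardy) \<Rightarrow> bool"
  where "is_axis_unitary a S U \<longleftrightarrow> unitary_on S UNIV U \<and>
    (\<forall>p \<eta>. \<forall>z\<in>ball 0 1. hardy_fun (U (tens (ket (replicate p a)) \<eta>)) z = z ^ p *\<^sub>C \<eta>)"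

lemma power_series_tens_ket: "cmod z < 1 \<Longrightarrow> power_series (tens (ket p) \<eta>) z = z ^ p *\<^sub>C \<eta>"
proof -
  assume "cmod z < 1"
  have "(\<Sum>k. z ^ k *\<^sub>C coord (tens (ket p) \<eta>) k) = (\<Sum>k\<in>{p}. z ^ k *\<^sub>C coord (tens (ket p) \<eta>) k)"
    by (rule suminf_finite) (auto simp: coord_tens_ket cvec.scale_zero_right)
  then show ?thesis
    using \<open>cmod z < 1\<close> by (simp add: power_series_def coord_tens_ket)
qed

lemma is_axis_unitary_exists:
  assumes "a \<in> {1..n}"
  shows "\<exists>U :: (nat list, 'a::chilbert_space) ell2 \<Rightarrow> 'a hardy.
    is_axis_unitary a (orth_complement_in (fock n) (off_axis n a)) U"
proof -
  let ?S = "orth_complement_in (fock n) (off_axis n a) :: (nat list, 'a) ell2 set"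
  let ?r = "\<lambda>p. replicate p a"
  define V where "V x = Abs_ell2 (\<lambda>p. coord x (?r p))" for x :: "(nat list, 'a) ell2"
  define U where "U x = hardy_of (V x)" for x
  have inj: "inj ?r" by (auto simp: inj_def dest: arg_cong[of _ _ length])
  have V: "coord (V x) p = coord x (?r p)" for x p
  proof -
    have "(\<lambda>\<mu>. (norm (coord x \<mu>))\<^sup>2) summable_on range ?r"
      by (rule summable_on_subset[OF square_summable_coord]) simp
    then have "(\<lambda>p. (norm (coord x (?r p)))\<^sup>2) summable_on UNIV"
      by (subst (asm) summable_on_reindex[OF inj]) (simp add: o_def)
    then show ?thesis by (simp add: V_def Abs_ell2_inverse)
  qed
  have Vadd: "V (x + y) = V x + V y" for x y by (rule ell2_eqI) (simp add: V plus_ell2.rep_eq)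
  have Vsc: "V (c *\<^sub>C x) = c *\<^sub>C V x" for c x by (rule ell2_eqI) (simp add: V scaleC_ell2.rep_eq)
  have Vin: "cinner (V x) (V y) = cinner x y" if "x \<in> ?S" for x y
  proof -
    have "cinner x y = (\<Sum>\<^sub>\<infinity>\<mu>\<in>range ?r. cinner (coord x \<mu>) (coord y \<mu>))"
      unfolding cinner_ell2_def
      by (rule infsum_cong_neutral) (use that in \<open>auto simp: axis_coord[OF assms]\<close>)
    also have "\<dots> = cinner (V x) (V y)"
      by (subst infsum_reindex[OF inj]) (simp add: o_def cinner_ell2_def V)
    finally show ?thesis by simp
  qed
  have cU: "hardy_coeffs (U x) = V x" for x by (simp add: U_def)
  have Uin: "cinner (U x) (U y) = cinner x y" if "x \<in> ?S" for x y
    using Vin[OF that] by (simp add: cinner_hardy_def cU)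
  have nU: "norm (U x) = norm x" if "x \<in> ?S" for x
    using Uin[OF that, of x] by (simp add: cinner_self flip: of_real_power)
  have surj: "f \<in> U ` ?S" for f
  proof -
    define g where "g \<mu> = (if \<mu> \<in> range ?r then coord (hardy_coeffs f) (length \<mu>) else 0)" for \<mu>
    have "(\<lambda>\<mu>. (norm (g \<mu>))\<^sup>2) summable_on range ?r"
      by (subst summable_on_reindex[OF inj]) (simp add: o_def g_def square_summable_coord)
    then have "(\<lambda>\<mu>. (norm (g \<mu>))\<^sup>2) summable_on UNIV"
      by (rule summable_on_cong_neutral[THEN iffD1, rotated -1]) (auto simp: g_def)
    then have g: "coord (Abs_ell2 g) = g" by (simp add: Abs_ell2_inverse)
    have "Abs_ell2 g \<in> ?S" by (simp add: axis_coord[OF assms] g g_def)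
    moreover have "V (Abs_ell2 g) = hardy_coeffs f"
      by (rule ell2_eqI) (simp add: V g g_def)
    then have "U (Abs_ell2 g) = f" by (simp add: U_def)
    ultimately show ?thesis by blast
  qed
  have "unitary_on ?S UNIV U"
    unfolding unitary_on_def bounded_clinear_on_def
  proof (intro conjI ballI allI)
    show "U (x + y) = U x + U y" "U (c *\<^sub>C x) = c *\<^sub>C U x" for x y c
      by (simp_all add: hardy_coeffs_inject[symmetric] hardy_coeffs_add hardy_coeffs_scaleC cU Vadd Vsc)
    show "\<exists>K. \<forall>x\<in>?S. norm (U x) \<le> K * norm x" by (rule exI[of _ 1]) (simp add: nU)
  qed (use surj Uin in auto)
  moreover have "V (tens (ket (?r p)) \<eta>) = tens (ket p) \<eta>" for p \<eta>
    using inj by (intro ell2_eqI) (auto simp: V coord_tens_ket inj_eq)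
  ultimately have "is_axis_unitary a ?S U"
    by (simp add: is_axis_unitary_def U_def hardy_fun_of power_series_tens_ket)
  then show ?thesis by blast
qed

section \<open>Operator-valued functions\<close>

text \<open>
  Bounded complex-linear operators, as a subset of the bounded real-linear ones; the norm is the
  operator norm of the library.
\<close>

definition clinear_blinfuns :: "('a::chilbert_space \<Rightarrow>\<^sub>L 'b::chilbert_space) set"
  where "clinear_blinfuns = {T. \<forall>c x. blinfun_apply T (c *\<^sub>C x) = c *\<^sub>C blinfun_apply T x}"

lift_definition scale_blinfun ::
  "complex \<Rightarrow> ('a::chilbert_space \<Rightarrow>\<^sub>L 'b::chilbert_space) \<Rightarrow> ('a \<Rightarrow>\<^sub>L 'b)"
  is "\<lambda>c T x. c *\<^sub>C T x"
  by (rule bounded_linear_compose[OF bounded_linear_scaleC_right])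

text \<open>
  The bounded analytic operator-valued functions on the unit disc, as functions vanishing off the
  disc.  Analyticity is complex differentiability in operator norm, that is, the Frechet
  derivative at \<open>z\<close> is \<open>h \<mapsto> h D\<close> for some operator \<open>D\<close>.
\<close>

definition Hinf :: "(complex \<Rightarrow> ('a::chilbert_space \<Rightarrow>\<^sub>L 'a)) set"
  where "Hinf = {\<Theta>.
    (\<forall>z\<in>ball 0 1. \<Theta> z \<in> clinear_blinfuns) \<and>
    (\<forall>z\<in>ball 0 1. \<exists>D\<in>clinear_blinfuns. (\<Theta> has_derivative (\<lambda>h. scale_blinfun h D)) (at z)) \<and>
    bounded (\<Theta> ` ball 0 1) \<and>
    (\<forall>z. z \<notin> ball 0 1 \<longrightarrow> \<Theta> z = 0)}"

text \<open>The function \<open>z \<mapsto> \<Theta>(z) f(z)\<close>, for \<open>f\<close> in the Hardy space.\<close>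

definition mult_op :: "(complex \<Rightarrow> ('a::chilbert_space \<Rightarrow>\<^sub>L 'a)) \<Rightarrow> 'a hardy \<Rightarrow> complex \<Rightarrow> 'a"
  where "mult_op \<Theta> f = (\<lambda>z. blinfun_apply (\<Theta> z) (hardy_fun f z))"

definition W22 :: "nat \<Rightarrow> ((nat list, 'a::chilbert_space) ell2 \<Rightarrow> (nat list, 'a) ell2) \<Rightarrow>
    (nat list, 'a) ell2 \<Rightarrow> (nat list, 'a) ell2"
  where "W22 n W x = orth_proj (M_perp n) (W x)"

definition symbol_coeff ::
  "('a::chilbert_space \<Rightarrow> (nat list, 'a) ell2) \<Rightarrow> nat \<Rightarrow> ('a \<Rightarrow>\<^sub>L 'a)"
  where "symbol_coeff L r = Blinfun (\<lambda>\<eta>. bra_tensor_id (ket (replicate r 1)) (L \<eta>))"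

lemma
  assumes "bounded_clinear_on UNIV S L"
  shows symbol_coeff_apply:
      "blinfun_apply (symbol_coeff L r) \<eta> = bra_tensor_id (ket (replicate r 1)) (L \<eta>)"
    and symbol_coeff_clinear: "symbol_coeff L r \<in> clinear_blinfuns"
proof -
  obtain K where K: "norm (L x) \<le> K * norm x" for x
    using assms by (auto simp: bounded_clinear_on_def)
  have L: "L (x + y) = L x + L y" "L (c *\<^sub>C x) = c *\<^sub>C L x" for x y c
    using assms by (auto simp: bounded_clinear_on_def)
  have "bounded_linear (\<lambda>\<eta>. bra_tensor_id (ket (replicate r 1)) (L \<eta>))"
    by (rule bounded_linear_intro[where K = K])
      (auto simp: bra_tensor_id_ket L scaleR_scaleC plus_ell2.rep_eq scaleC_ell2.rep_eq mult.commute[of _ K]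
        intro: order_trans[OF norm_coord_le K])
  then show *: "blinfun_apply (symbol_coeff L r) \<eta> = bra_tensor_id (ket (replicate r 1)) (L \<eta>)" for \<eta>
    by (simp add: symbol_coeff_def bounded_linear_Blinfun_apply)
  show "symbol_coeff L r \<in> clinear_blinfuns"
    by (simp add: clinear_blinfuns_def * bra_tensor_id_ket L scaleC_ell2.rep_eq)
qed

end

theory Submission
  imports Defs
begin

text \<open>
  Since \<open>W\<close> sends \<open>e\<^sub>n\<^sup>p \<otimes> \<eta>\<close> to \<open>e\<^sub>1\<^sup>p \<otimes> L \<eta>\<close>, \<open>T = U\<^sub>1 W\<^sub>2\<^sub>2 U\<^sub>n\<^sup>*\<close> maps \<open>z\<^sup>p \<eta>\<close> to
  \<open>z\<^sup>p \<Sum>\<^sub>r z\<^sup>r L\<^sub>r \<eta> = z\<^sup>p \<Theta>(z) \<eta>\<close>.  As evaluation at \<open>w\<close> is continuous on the Hardy space and the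
  monomials span a dense subspace, \<open>T\<close> is multiplication by \<open>\<Theta>\<close>.  The symbol is bounded because
  evaluating \<open>T (k\<^sub>w \<eta>) = \<Theta> k\<^sub>w \<eta>\<close> at \<open>w\<close>, where \<open>k\<^sub>w\<close> is the Szego kernel, gives
  \<open>\<parallel>k\<^sub>w\<parallel>\<^sup>2 \<parallel>\<Theta>(w) \<eta>\<parallel> \<le> \<parallel>k\<^sub>w\<parallel> \<parallel>T\<parallel> \<parallel>k\<^sub>w\<parallel> \<parallel>\<eta>\<parallel>\<close>.
\<close>

section \<open>Operator-valued power series\<close>

lemma norm_scale_blinfun_le: "norm (scale_blinfun c T) \<le> cmod c * norm T"
  by (rule norm_blinfun_bound)
    (simp_all add: scale_blinfun.rep_eq mult.assoc mult_left_mono norm_blinfun)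

lemma scale_blinfun_scale: "scale_blinfun c (scale_blinfun d T) = scale_blinfun (c * d) T"
  by (rule blinfun_eqI) (simp add: scale_blinfun.rep_eq scaleC_scaleC)

lemma bounded_linear_scale_blinfun_left: "bounded_linear (\<lambda>c. scale_blinfun c T)"
proof (rule bounded_linear_intro[where K = "norm T"])
  show "scale_blinfun (r *\<^sub>R c) T = r *\<^sub>R scale_blinfun c T" for r c
    by (rule blinfun_eqI)
      (simp add: scale_blinfun.rep_eq blinfun.scaleR_left scaleR_scaleC[of r "c *\<^sub>C _"]
        scaleC_scaleC scaleR_conv_of_real)
qed (auto intro!: blinfun_eqI norm_scale_blinfun_le
      simp: scale_blinfun.rep_eq blinfun.add_left scaleC_add_left)

lemma bounded_linear_scale_blinfun_right: "bounded_linear (scale_blinfun c)"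
  by (rule bounded_linear_intro[where K = "cmod c"])
    (auto intro!: blinfun_eqI norm_scale_blinfun_le
      simp: scale_blinfun.rep_eq blinfun.add_left blinfun.scaleR_left scaleC_add_right
        scaleR_scaleC scaleC_scaleC mult.commute[of _ c] mult.commute[of _ "cmod c"])

lemma scale_blinfun_clinear: "T \<in> clinear_blinfuns \<Longrightarrow> scale_blinfun c T \<in> clinear_blinfuns"
  by (simp add: clinear_blinfuns_def scale_blinfun.rep_eq scaleC_scaleC mult.commute)

text \<open>Evaluation at a vector and multiplication by a complex scalar are both continuous, so
  complex linearity survives norm limits.\<close>

lemma sums_clinear_blinfuns:
  assumes "f sums T" "\<And>r. f r \<in> clinear_blinfuns"
  shows "T \<in> clinear_blinfuns"
  unfolding clinear_blinfuns_def
proof (intro CollectI allI)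
  fix c x
  have ap: "(\<lambda>r. blinfun_apply (f r) y) sums blinfun_apply T y" for y
    using assms(1) by (rule bounded_linear.sums[OF blinfun.bounded_linear_left])
  have "(\<lambda>r. c *\<^sub>C blinfun_apply (f r) x) sums (c *\<^sub>C blinfun_apply T x)"
    by (rule bounded_linear.sums[OF bounded_linear_scaleC_right ap])
  then show "blinfun_apply T (c *\<^sub>C x) = c *\<^sub>C blinfun_apply T x"
    using ap[of "c *\<^sub>C x"] assms(2) sums_unique2 by (fastforce simp: clinear_blinfuns_def)
qed

text \<open>The termwise derivative of the geometric series converges on the same disc. The
  truncated exponent at \<open>r = 0\<close> is harmless because of the factor
  \<open>real r\<close>.\<close>

lemma summable_norm_deriv_powers:
  assumes "0 \<le> \<rho>" "\<rho> < 1"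
  shows "summable (\<lambda>r. real r * \<rho> ^ (r - 1))"
proof -
  have "summable (\<lambda>n. diffs (\<lambda>_. 1) n * \<rho> ^ n)"
    by (rule termdiff_converges[of _ 1]) (use assms in \<open>auto intro!: summable_geometric\<close>)
  then have "summable (\<lambda>n. real (Suc n) * \<rho> ^ (Suc n - 1))"
    by (simp add: diffs_def)
  then show ?thesis
    by (subst (asm) summable_Suc_iff)
qed

lemma summable_scale_blinfun_powers:
  fixes c :: "nat \<Rightarrow> ('a::chilbert_space \<Rightarrow>\<^sub>L 'b::chilbert_space)"
  assumes "\<And>r. norm (c r) \<le> K" "cmod z < 1"
  shows "summable (\<lambda>r. scale_blinfun (z ^ r) (c r))"
proof (rule summable_comparison_test')
  show "summable (\<lambda>r. cmod z ^ r * K)"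
    using assms by (intro summable_mult2 summable_geometric) simp
  show "norm (scale_blinfun (z ^ r) (c r)) \<le> cmod z ^ r * K" for r
    using order_trans[OF norm_scale_blinfun_le mult_left_mono[OF assms(1)[of r] norm_ge_zero], of "z ^ r"]
    by (simp add: norm_power)
qed

text \<open>Termwise differentiation: the differentiated series converges uniformly in operator norm
  on a smaller disc around 0 that contains \<open>z\<close>. Its sum at \<open>z\<close> is the
  derivative, and it is complex linear as a norm limit of complex-linear operators.\<close>

lemma scale_blinfun_power_series_has_derivative:
  fixes c :: "nat \<Rightarrow> ('a::chilbert_space \<Rightarrow>\<^sub>L 'b::chilbert_space)"
  assumes K: "\<And>r. norm (c r) \<le> K"
    and c: "\<And>r. c r \<in> clinear_blinfuns"
    and z: "cmod z < 1"
    and \<Theta>: "\<And>w. cmod w < 1 \<Longrightarrow> (\<lambda>r. scale_blinfun (w ^ r) (c r)) sums \<Theta> w"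
  shows "\<exists>D\<in>clinear_blinfuns. (\<Theta> has_derivative (\<lambda>h. scale_blinfun h D)) (at z)"
proof -
  \<comment> \<open>The gap between \<open>\<rho>\<close> and 1 makes the majorant \<open>M\<close>
    summable; the gap between \<open>cmod z\<close> and \<open>\<rho>\<close> makes
    \<open>ball 0 \<rho>\<close> a neighbourhood of \<open>z\<close>.\<close>
  obtain \<rho> where \<rho>: "cmod z < \<rho>" "\<rho> < 1" using dense[OF z] by blast
  then have \<rho>0: "0 < \<rho>" by (meson norm_ge_zero le_less_trans)
  define t where "t r w = scale_blinfun (of_nat r * w ^ (r - 1)) (c r)" for r w
  define M where "M r = real r * \<rho> ^ (r - 1) * K" for r
  define D where "D w = (\<Sum>r. t r w)" for w
  have M: "summable M"
    unfolding M_def using \<rho> \<rho>0 by (intro summable_mult2 summable_norm_deriv_powers) auto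
  have t_le: "norm (t r w) \<le> M r" if "w \<in> ball 0 \<rho>" for r w
  proof -
    have "norm (t r w) \<le> cmod (of_nat r * w ^ (r - 1)) * norm (c r)"
      unfolding t_def by (rule norm_scale_blinfun_le)
    also have "\<dots> \<le> real r * \<rho> ^ (r - 1) * K"
      using that by (intro mult_mono K) (use \<rho>0 in \<open>auto simp: norm_mult norm_power intro!: mult_left_mono power_mono\<close>)
    finally show ?thesis by (simp add: M_def)
  qed
  have unif: "uniform_limit (ball 0 \<rho>) (\<lambda>n w. \<Sum>r<n. t r w) D sequentially"
    unfolding D_def by (rule Weierstrass_m_test[OF t_le M])
  have "\<exists>g. \<forall>x\<in>ball 0 \<rho>. (\<lambda>r. scale_blinfun (x ^ r) (c r)) sums g x \<and>
      (g has_derivative (\<lambda>h. scale_blinfun h (D x))) (at x within ball 0 \<rho>)"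
  proof (rule has_derivative_series)
    show "((\<lambda>x. scale_blinfun (x ^ r) (c r)) has_derivative (\<lambda>h. scale_blinfun h (t r x)))
        (at x within ball 0 \<rho>)" for r x
    proof -
      have "((\<lambda>x. x ^ r) has_derivative (\<lambda>h. h * (of_nat r * x ^ (r - 1)))) (at x within ball 0 \<rho>)"
        by (auto intro!: derivative_eq_intros simp: algebra_simps)
      from bounded_linear.has_derivative[OF bounded_linear_scale_blinfun_left this]
      show ?thesis by (simp add: t_def scale_blinfun_scale)
    qed
    show "\<forall>\<^sub>F n in sequentially. \<forall>x\<in>ball 0 \<rho>. \<forall>h.
        norm ((\<Sum>i<n. scale_blinfun h (t i x)) - scale_blinfun h (D x)) \<le> e * norm h"
      if "e > 0" for e
      using uniform_limitD[OF unif that]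
    proof eventually_elim
      case (elim n)
      show ?case
      proof (intro ballI allI)
        fix x h assume "x \<in> ball (0::complex) \<rho>"
        then have "norm ((\<Sum>i<n. t i x) - D x) \<le> e" using elim by (force simp: dist_norm)
        \<comment> \<open>The increment \<open>h\<close> factors out by linearity, so the error is
          at most \<open>cmod h\<close> times the uniform error of the partial sums.\<close>
        moreover have "(\<Sum>i<n. scale_blinfun h (t i x)) - scale_blinfun h (D x)
            = scale_blinfun h ((\<Sum>i<n. t i x) - D x)"
          by (simp add: linear_diff linear_sum bounded_linear.linear[OF bounded_linear_scale_blinfun_right])
        ultimately show "norm ((\<Sum>i<n. scale_blinfun h (t i x)) - scale_blinfun h (D x)) \<le> e * norm h"
          using order_trans[OF norm_scale_blinfun_le mult_left_mono]
          by (metis mult.commute norm_ge_zero)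
      qed
    qed
    show "(\<lambda>r. scale_blinfun (z ^ r) (c r)) sums \<Theta> z" using \<Theta>[OF z] .
  qed (use \<rho> in auto)
  then obtain g where g: "\<And>x. x \<in> ball 0 \<rho> \<Longrightarrow> (\<lambda>r. scale_blinfun (x ^ r) (c r)) sums g x"
    "(g has_derivative (\<lambda>h. scale_blinfun h (D z))) (at z within ball 0 \<rho>)"
    using \<rho> by fastforce
  \<comment> \<open>Uniqueness of sums identifies the function produced by termwise differentiation
    with \<open>\<Theta>\<close> near \<open>z\<close>.\<close>
  have "g x = \<Theta> x" if "x \<in> ball 0 \<rho>" for x
    using g(1)[OF that] \<Theta>[of x] that \<rho> by (auto intro: sums_unique2)
  then have "(\<Theta> has_derivative (\<lambda>h. scale_blinfun h (D z))) (at z within ball 0 \<rho>)"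
    using \<rho> by (intro has_derivative_transform[OF _ _ g(2)]) auto
  then have "(\<Theta> has_derivative (\<lambda>h. scale_blinfun h (D z))) (at z)"
    using \<rho> by (simp add: at_within_open[of z "ball 0 \<rho>"])
  moreover have "(\<lambda>r. t r z) sums D z"
    unfolding D_def
    by (rule summable_sums, rule summable_comparison_test'[OF M], rule t_le) (use \<rho> in simp)
  then have "D z \<in> clinear_blinfuns"
    by (rule sums_clinear_blinfuns) (simp add: t_def scale_blinfun_clinear c)
  ultimately show ?thesis by blast
qed

section \<open>The Szego kernel\<close>

text \<open>The Taylor coefficients of the Szego kernel 1 / (1 - \<open>cnj w\<close> z). The
  conjugate cancels against the conjugate-linear first slot of \<open>cinner\<close>; the value 0
  for \<open>cmod w \<ge> 1\<close> keeps the family square-summable for every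
  \<open>w\<close>.\<close>

lift_definition szego :: "complex \<Rightarrow> (nat, complex) ell2"
  is "\<lambda>w k. if cmod w < 1 then cnj w ^ k else 0"
proof -
  fix w :: complex
  have "(\<lambda>k. ((cmod w)\<^sup>2) ^ k) summable_on UNIV" if "cmod w < 1"
  proof (rule norm_summable_imp_summable_on)
    show "summable (\<lambda>k. norm (((cmod w)\<^sup>2) ^ k))"
      using that unfolding norm_power by (intro summable_geometric) (simp add: abs_square_less_1)
  qed
  then show "(\<lambda>k. (norm (if cmod w < 1 then cnj w ^ k else 0))\<^sup>2) summable_on UNIV"
    by (cases "cmod w < 1") (simp_all add: norm_power power_mult[symmetric] mult.commute[of 2])
qed

text \<open>The reproducing property of the kernel, tested in the direction
  \<open>\<zeta>\<close>.\<close>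

lemma cinner_szego:
  assumes "cmod w < 1"
  shows "cinner (tens (szego w) \<zeta>) a = cinner \<zeta> (power_series a w)"
proof -
  have "(\<lambda>k. cinner (coord (tens (szego w) \<zeta>) k) (coord a k)) summable_on UNIV"
    by (intro square_summable_cinner square_summable_coord)
  then have "(\<lambda>k. cinner (coord (tens (szego w) \<zeta>) k) (coord a k)) sums cinner (tens (szego w) \<zeta>) a"
    unfolding cinner_ell2_def by (intro has_sum_imp_sums has_sum_infsum)
  moreover have "cinner (coord (tens (szego w) \<zeta>) k) (coord a k) = cinner \<zeta> (w ^ k *\<^sub>C coord a k)" for k
    using assms by (simp add: tens.rep_eq szego.rep_eq cinner_scaleC_left cinner_scaleC_right)
  moreover have "(\<lambda>k. cinner \<zeta> (w ^ k *\<^sub>C coord a k)) sums cinner \<zeta> (power_series a w)"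
    using bounded_linear.sums[OF bounded_linear_cinner_right summable_sums[OF power_series_summable[OF assms]]]
      assms by (simp add: power_series_def)
  ultimately show ?thesis by (simp add: sums_unique2)
qed

lemma norm_tens: "norm (tens f \<eta>) = norm f * norm \<eta>"
proof -
  have "complex_of_real ((norm (tens f \<eta>))\<^sup>2) = complex_of_real ((norm f * norm \<eta>)\<^sup>2)"
    unfolding cinner_self[symmetric] cinner_tens power_mult_distrib of_real_mult by (simp add: cinner_self)
  then have "(norm (tens f \<eta>))\<^sup>2 = (norm f * norm \<eta>)\<^sup>2" using of_real_eq_iff by blast
  then show ?thesis by (simp add: power2_eq_iff_nonneg)
qed

lemma norm_tens_ket: "norm (tens (ket i) \<eta>) = norm \<eta>"
  using cinner_tens_ket[of i \<eta> "tens (ket i) \<eta>"]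
  by (simp add: coord_tens_ket cinner_self flip: of_real_power)

text \<open>Point evaluation is bounded: take the value at \<open>w\<close> itself as the direction
  in the reproducing property and apply Cauchy-Schwarz.\<close>

lemma norm_power_series_le:
  assumes "cmod w < 1"
  shows "norm (power_series a w) \<le> norm (szego w) * norm a"
proof (cases "power_series a w = 0")
  case False
  let ?y = "power_series a w"
  have "(norm ?y)\<^sup>2 = cmod (cinner (tens (szego w) ?y) a)"
    by (simp add: cinner_szego[OF assms] cinner_self norm_power)
  also have "\<dots> \<le> norm (szego w) * norm ?y * norm a"
    using cmod_cinner_le[of "tens (szego w) ?y" a] by (simp add: norm_tens)
  finally show ?thesis using False by (simp add: power2_eq_square)
qed simp

text \<open>The reproducing property applied to the kernel itself; pairing with every
  \<open>\<zeta>\<close> determines the vector.\<close>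

lemma power_series_szego:
  assumes "cmod w < 1"
  shows "power_series (tens (szego w) \<eta>) w = complex_of_real ((norm (szego w))\<^sup>2) *\<^sub>C \<eta>"
proof -
  have "cinner \<zeta> (power_series (tens (szego w) \<eta>) w) = cinner \<zeta> (complex_of_real ((norm (szego w))\<^sup>2) *\<^sub>C \<eta>)" for \<zeta>
    by (simp only: cinner_szego[OF assms, symmetric] cinner_tens cinner_scaleC_right cinner_self)
  then have "cinner \<zeta> (power_series (tens (szego w) \<eta>) w - complex_of_real ((norm (szego w))\<^sup>2) *\<^sub>C \<eta>) = 0" for \<zeta>
    by (simp add: cinner_diff_right)
  from this[of "power_series (tens (szego w) \<eta>) w - complex_of_real ((norm (szego w))\<^sup>2) *\<^sub>C \<eta>"]
  show ?thesis by (simp add: cinner_self)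
qed

text \<open>The constant coefficient is 1. Positivity later permits cancelling the kernel
  norm.\<close>

lemma norm_szego_pos:
  assumes "cmod w < 1"
  shows "norm (szego w) > 0"
proof -
  have "coord (szego w) 0 = 1" using assms by (simp add: szego.rep_eq)
  then show ?thesis using norm_coord_le[of "szego w" 0] by (simp del: zero_less_norm_iff)
qed

lemma bounded_linear_power_series: "cmod w < 1 \<Longrightarrow> bounded_linear (\<lambda>a. power_series a w)"
  by (rule bounded_linear_intro[where K = "norm (szego w)"])
    (simp_all add: power_series_add scaleR_scaleC power_series_scaleC norm_power_series_le
      mult.commute[of "norm _" "norm (szego w)"])

section \<open>Toeplitz operators on the Hardy space\<close>

lemma norm_hardy_coeffs: "norm (hardy_coeffs f) = norm f"
  by (simp add: norm_eq_sqrt_inner inner_hardy_def)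

lemma hardy_of_simps:
  "hardy_of (a + b) = hardy_of a + hardy_of b" "hardy_of (c *\<^sub>C a) = c *\<^sub>C hardy_of a"
  "norm (hardy_of a) = norm a"
  by (simp_all add: hardy_coeffs_inject[symmetric] hardy_coeffs_add hardy_coeffs_scaleC
      norm_hardy_coeffs[symmetric])

lemma ell2_cspan_dense: "closure (cspan {tens (ket i) (\<eta>::'a::chilbert_space) | i \<eta>. True}) = UNIV"
  using closure_cspan_tens[of UNIV] by simp

text \<open>The hypothesis \<open>toeplitz\<close> says that the block matrix of \<open>T\<close> is
  lower triangular and constant along diagonals; \<open>\<Theta>\<close> is the value of the symbol
  at the fixed point \<open>z\<close>. Both sides depend linearly and continuously on the
  coefficients of \<open>f\<close> and agree on monomials, whose span is dense.\<close>

lemma toeplitz_eq_mult_op: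
  fixes T :: "'a::chilbert_space hardy \<Rightarrow> 'a hardy" and \<Theta> :: "'a \<Rightarrow>\<^sub>L 'a"
  assumes T: "bounded_clinear_on UNIV UNIV T"
    and toeplitz: "\<And>p \<eta> k. coord (hardy_coeffs (T (hardy_of (tens (ket p) \<eta>)))) k
      = (if k < p then 0 else blinfun_apply (c (k - p)) \<eta>)"
    and \<Theta>: "(\<lambda>r. scale_blinfun (z ^ r) (c r)) sums \<Theta>" "\<Theta> \<in> clinear_blinfuns"
    and z: "cmod z < 1"
  shows "hardy_fun (T f) z = blinfun_apply \<Theta> (hardy_fun f z)"
proof -
  obtain K where K: "norm (T x) \<le> K * norm x" for x
    using T by (auto simp: bounded_clinear_on_def)
  have lin: "T (x + y) = T x + T y" "T (s *\<^sub>C x) = s *\<^sub>C T x" for x y s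
    using T by (auto simp: bounded_clinear_on_def)
  define F where "F a = power_series (hardy_coeffs (T (hardy_of a))) z" for a
  define G where "G a = blinfun_apply \<Theta> (power_series a z)" for a
  have F_lin: "F (a + b) = F a + F b" "F (s *\<^sub>C a) = s *\<^sub>C F a" for a b s
    by (simp_all add: F_def hardy_of_simps lin hardy_coeffs_add hardy_coeffs_scaleC
        power_series_add power_series_scaleC)
  have G_lin: "G (a + b) = G a + G b" "G (s *\<^sub>C a) = s *\<^sub>C G a" for a b s
    using \<Theta>(2) by (simp_all add: G_def power_series_add power_series_scaleC blinfun.add_right clinear_blinfuns_def)
  have "bounded_linear (\<lambda>a. hardy_coeffs (T (hardy_of a)))"
    by (rule bounded_linear_intro[where K = K])
      (use K in \<open>simp_all add: hardy_of_simps lin hardy_coeffs_add hardy_coeffs_scaleC scaleR_scaleC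
        norm_hardy_coeffs, metis hardy_of_simps(3) mult.commute\<close>)
  then have F: "continuous_on UNIV F"
    unfolding F_def by (intro linear_continuous_on bounded_linear_compose[OF bounded_linear_power_series[OF z]])
  have G: "continuous_on UNIV G"
    unfolding G_def by (intro linear_continuous_on bounded_linear_compose[OF blinfun.bounded_linear_right]
        bounded_linear_power_series z)
  have gen: "F (tens (ket p) \<eta>) = G (tens (ket p) \<eta>)" for p \<eta>
  proof -
    let ?b = "hardy_coeffs (T (hardy_of (tens (ket p) \<eta>)))"
    have "(\<lambda>r. blinfun_apply (scale_blinfun (z ^ r) (c r)) \<eta>) sums blinfun_apply \<Theta> \<eta>"
      by (rule bounded_linear.sums[OF blinfun.bounded_linear_left \<Theta>(1)])
    from bounded_linear.sums[OF bounded_linear_scaleC_right this, of "z ^ p"]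
    have "(\<lambda>r. z ^ (r + p) *\<^sub>C coord ?b (r + p)) sums (z ^ p *\<^sub>C blinfun_apply \<Theta> \<eta>)"
      by (simp add: toeplitz scale_blinfun.rep_eq scaleC_scaleC power_add mult.commute)
    \<comment> \<open>The first \<open>p\<close> coefficients vanish, so undoing the shift does not
      change the sum.\<close>
    then have "(\<lambda>k. z ^ k *\<^sub>C coord ?b k) sums (z ^ p *\<^sub>C blinfun_apply \<Theta> \<eta>)"
      by (subst (asm) sums_zero_iff_shift) (simp_all add: toeplitz cvec.scale_zero_right)
    then have "F (tens (ket p) \<eta>) = z ^ p *\<^sub>C blinfun_apply \<Theta> \<eta>"
      using z by (simp add: F_def power_series_def sums_iff)
    then show ?thesis
      using \<Theta>(2) z by (simp add: G_def power_series_tens_ket clinear_blinfuns_def)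
  qed
  have zero: "F 0 = G 0" using F_lin(2)[of 0 0] G_lin(2)[of 0 0] by (simp add: cvec.scale_zero_left)
  have "csubspace {a. F a = G a}"
    by (auto simp: cvec.subspace_def zero F_lin G_lin)
  then have "cspan {tens (ket i) \<eta> | i \<eta>. True} \<subseteq> {a. F a = G a}"
    by (intro cvec.span_minimal) (auto simp: gen)
  moreover have "closed {a. F a = G a}" by (rule closed_Collect_eq[OF F G])
  ultimately have "closure (cspan {tens (ket i) (\<eta>::'a) | i \<eta>. True}) \<subseteq> {a. F a = G a}"
    by (rule closure_minimal)
  then have "F (hardy_coeffs f) = G (hardy_coeffs f)" unfolding ell2_cspan_dense by blast
  then show ?thesis by (simp add: F_def G_def hardy_fun_eq)
qed

text \<open>On a kernel function, point evaluation and the norm of the input each cost one factor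
  \<open>norm (szego w)\<close>, and these cancel against the value of the kernel at
  \<open>w\<close>. The resulting bound does not depend on \<open>w\<close>.\<close>

lemma mult_op_symbol_norm_le:
  fixes T :: "'a::chilbert_space hardy \<Rightarrow> 'a hardy" and \<Theta> :: "'a \<Rightarrow>\<^sub>L 'a"
  assumes K: "\<And>f. norm (T f) \<le> K * norm f" "0 \<le> K"
    and mult: "\<And>f. hardy_fun (T f) w = blinfun_apply \<Theta> (hardy_fun f w)"
    and \<Theta>: "\<Theta> \<in> clinear_blinfuns"
    and w: "cmod w < 1"
  shows "norm \<Theta> \<le> K"
proof (rule norm_blinfun_bound[OF K(2)])
  fix \<eta> :: 'a
  let ?k = "norm (szego w)" and ?f = "hardy_of (tens (szego w) \<eta>)"
  have "blinfun_apply \<Theta> (hardy_fun ?f w) = complex_of_real (?k\<^sup>2) *\<^sub>C blinfun_apply \<Theta> \<eta>"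
    using \<Theta> w by (simp add: hardy_fun_of power_series_szego clinear_blinfuns_def)
  then have "?k\<^sup>2 * norm (blinfun_apply \<Theta> \<eta>) = norm (hardy_fun (T ?f) w)"
    by (simp add: mult norm_power)
  also have "\<dots> \<le> ?k * norm (T ?f)"
    using norm_power_series_le[OF w, of "hardy_coeffs (T ?f)"] by (simp add: hardy_fun_eq norm_hardy_coeffs)
  also have "\<dots> \<le> ?k * (K * (?k * norm \<eta>))"
    using K(1)[of ?f] by (intro mult_left_mono) (simp_all add: hardy_of_simps norm_tens)
  finally have "?k\<^sup>2 * norm (blinfun_apply \<Theta> \<eta>) \<le> ?k\<^sup>2 * (K * norm \<eta>)"
    by (simp add: power2_eq_square algebra_simps)
  then show "norm (blinfun_apply \<Theta> \<eta>) \<le> K * norm \<eta>"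
    using norm_szego_pos[OF w] by simp
qed

text \<open>Constant functions recover the symbol on the disc; off the disc membership in
  \<open>Hinf\<close> forces the value 0.\<close>

lemma mult_op_inj:
  assumes "\<Theta> \<in> Hinf" "\<Theta>' \<in> Hinf" "\<And>f. mult_op \<Theta> f = mult_op \<Theta>' f"
  shows "\<Theta> = \<Theta>'"
proof
  fix z
  show "\<Theta> z = \<Theta>' z"
  proof (cases "z \<in> ball 0 1")
    case True
    have "blinfun_apply (\<Theta> z) \<eta> = blinfun_apply (\<Theta>' z) \<eta>" for \<eta>
      using fun_cong[OF assms(3)[of "hardy_of (tens (ket 0) \<eta>)"], of z] True
      by (simp add: mult_op_def hardy_fun_of power_series_tens_ket)
    then show ?thesis by (rule blinfun_eqI)
  qed (use assms in \<open>simp add: Hinf_def\<close>)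
qed

lemma toeplitz_operator_symbol:
  fixes T :: "'a::chilbert_space hardy \<Rightarrow> 'a hardy" and c :: "nat \<Rightarrow> ('a \<Rightarrow>\<^sub>L 'a)"
  assumes T: "bounded_clinear_on UNIV UNIV T"
    and c: "\<And>r. c r \<in> clinear_blinfuns"
    and toeplitz: "\<And>p \<eta> k. coord (hardy_coeffs (T (hardy_of (tens (ket p) \<eta>)))) k
      = (if k < p then 0 else blinfun_apply (c (k - p)) \<eta>)"
  obtains \<Theta> where "\<Theta> \<in> Hinf" "\<And>f. hardy_fun (T f) = mult_op \<Theta> f"
    "\<And>z. z \<in> ball 0 1 \<Longrightarrow> (\<lambda>r. scale_blinfun (z ^ r) (c r)) sums \<Theta> z"
proof -
  obtain K0 where "norm (T x) \<le> K0 * norm x" for x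
    using T by (auto simp: bounded_clinear_on_def)
  \<comment> \<open>On a trivial space \<open>K0\<close> could be negative, while
    \<open>norm_blinfun_bound\<close> asks for a nonnegative bound.\<close>
  then have K: "norm (T x) \<le> \<bar>K0\<bar> * norm x" for x
    by (rule order_trans) (simp add: mult_right_mono)
  \<comment> \<open>\<open>c r\<close> applied to \<open>\<eta>\<close> is the coefficient of index
    \<open>r\<close> of the image of the constant function \<open>\<eta>\<close>, so the bound of
    \<open>T\<close> controls it.\<close>
  have cK: "norm (c r) \<le> \<bar>K0\<bar>" for r
  proof (rule norm_blinfun_bound)
    fix \<eta>
    have "norm (blinfun_apply (c r) \<eta>) \<le> norm (hardy_coeffs (T (hardy_of (tens (ket 0) \<eta>))))"
      using norm_coord_le[of "hardy_coeffs (T (hardy_of (tens (ket 0) \<eta>)))" r] by (simp add: toeplitz)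
    also have "\<dots> \<le> \<bar>K0\<bar> * norm \<eta>"
      using K[of "hardy_of (tens (ket 0) \<eta>)"] by (simp add: norm_hardy_coeffs hardy_of_simps norm_tens_ket)
    finally show "norm (blinfun_apply (c r) \<eta>) \<le> \<bar>K0\<bar> * norm \<eta>" .
  qed simp
  define \<Theta> where "\<Theta> z = (if cmod z < 1 then \<Sum>r. scale_blinfun (z ^ r) (c r) else 0)" for z
  have sums: "(\<lambda>r. scale_blinfun (z ^ r) (c r)) sums \<Theta> z" if "cmod z < 1" for z
    using summable_sums[OF summable_scale_blinfun_powers[of c, OF cK that]] that by (simp add: \<Theta>_def)
  have clin: "\<Theta> z \<in> clinear_blinfuns" if "cmod z < 1" for z
    using sums[OF that] by (rule sums_clinear_blinfuns) (simp add: scale_blinfun_clinear c)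
  have mult: "hardy_fun (T f) z = blinfun_apply (\<Theta> z) (hardy_fun f z)" if "cmod z < 1" for f z
    by (rule toeplitz_eq_mult_op[OF T toeplitz sums[OF that] clin[OF that] that])
  have "norm (\<Theta> z) \<le> \<bar>K0\<bar>" if "cmod z < 1" for z
    by (rule mult_op_symbol_norm_le[OF K _ mult[OF that] clin[OF that] that]) simp
  then have "bounded (\<Theta> ` ball 0 1)" by (auto simp: bounded_iff intro!: exI[of _ "\<bar>K0\<bar>"])
  moreover have "\<exists>D\<in>clinear_blinfuns. (\<Theta> has_derivative (\<lambda>h. scale_blinfun h D)) (at z)" if "cmod z < 1" for z
    by (rule scale_blinfun_power_series_has_derivative[OF cK c that sums])
  ultimately have "\<Theta> \<in> Hinf"
    using clin by (auto simp: Hinf_def \<Theta>_def)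
  moreover have "hardy_fun (T f) = mult_op \<Theta> f" for f
  proof
    \<comment> \<open>Off the disc both sides are 0, by the conventions for Hardy functions and for
      \<open>\<Theta>\<close>.\<close>
    show "hardy_fun (T f) z = mult_op \<Theta> f z" for z
    proof (cases "cmod z < 1")
      case True
      then show ?thesis by (simp add: mult mult_op_def)
    qed (simp add: mult_op_def hardy_fun_eq power_series_def \<Theta>_def)
  qed
  ultimately show ?thesis using that sums by auto
qed

section \<open>Compression to the axes\<close>

text \<open>\<open>U\<close> is known only on elementary tensors. Pairing \<open>U x\<close> with
  the image of such a tensor reads off a coefficient, and unitarity moves the pairing back to
  \<open>x\<close>.\<close>

lemma axis_unitary_coeffs:
  fixes U :: "(nat list, 'a::chilbert_space) ell2 \<Rightarrow> 'a hardy"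
  assumes a: "a \<in> {1..n}" and S: "S = orth_complement_in (fock n) (off_axis n a)"
    and U: "is_axis_unitary a S U" and x: "x \<in> S"
  shows "coord (hardy_coeffs (U x)) k = coord x (replicate k a)"
proof -
  have "cinner \<eta> (coord (hardy_coeffs (U x)) k) = cinner \<eta> (coord x (replicate k a))" for \<eta>
  proof -
    let ?t = "tens (ket (replicate k a)) \<eta>"
    have t: "?t \<in> S" by (auto simp: S axis_coord[OF a] coord_tens_ket)
    have "hardy_coeffs (U ?t) = tens (ket k) \<eta>"
    proof (rule hardy_coeffs_eqI)
      show "hardy_fun (U ?t) z = power_series (tens (ket k) \<eta>) z" for z
      proof (cases "cmod z < 1")
        case True
        then show ?thesis using U by (simp add: is_axis_unitary_def power_series_tens_ket)
      qed (simp add: hardy_fun_eq power_series_def)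
    qed
    then have "cinner \<eta> (coord (hardy_coeffs (U x)) k) = cinner (U ?t) (U x)"
      by (simp add: cinner_hardy_def cinner_tens_ket)
    also have "\<dots> = cinner ?t x"
      using U x t by (simp add: is_axis_unitary_def unitary_on_def)
    finally show ?thesis by (simp add: cinner_tens_ket)
  qed
  then have "cinner \<eta> (coord (hardy_coeffs (U x)) k - coord x (replicate k a)) = 0" for \<eta>
    by (simp add: cinner_diff_right)
  from this[of "coord (hardy_coeffs (U x)) k - coord x (replicate k a)"] show ?thesis
    by (simp add: cinner_self)
qed

lemma orth_complement_in_fock_diff:
  "x \<in> orth_complement_in (fock n) S \<Longrightarrow> y \<in> orth_complement_in (fock n) S \<Longrightarrow>
    x - y \<in> orth_complement_in (fock n) S"
  by (auto simp: orth_complement_in_def fock_def minus_ell2.rep_eq cinner_diff_right)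

text \<open>The preimage of \<open>f\<close> satisfies the defining property of the adjoint because
  \<open>U\<close> preserves inner products. Two candidates differ by an element of \<open>A\<close>
  orthogonal to itself, so the description is unique and the adjoint inverts
  \<open>U\<close>.\<close>

lemma adjoint_on_unitary:
  assumes U: "unitary_on A UNIV U" and diff: "\<And>x y. x \<in> A \<Longrightarrow> y \<in> A \<Longrightarrow> x - y \<in> A"
  shows "adjoint_on A U f \<in> A \<and> U (adjoint_on A U f) = f"
proof -
  obtain x where x: "x \<in> A" "U x = f"
    using U unfolding unitary_on_def by (metis UNIV_I imageE)
  have "adjoint_on A U f = x"
    unfolding adjoint_on_def
  proof (rule the_equality)
    show *: "x \<in> A \<and> (\<forall>a\<in>A. cinner (U a) f = cinner a x)"
      using U x by (auto simp: unitary_on_def)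
    fix y assume y: "y \<in> A \<and> (\<forall>a\<in>A. cinner (U a) f = cinner a y)"
    then have "cinner a (y - x) = 0" if "a \<in> A" for a
      using that * by (simp add: cinner_diff_right)
    then have "cinner (y - x) (y - x) = 0" using diff x y by blast
    then show "y = x" by (simp add: cinner_self)
  qed
  then show ?thesis using x by simp
qed

text \<open>The projection is truncation: keep the coordinates at the powers of the letter
  \<open>a\<close> and set all others to 0.\<close>

lemma orth_proj_axis:
  fixes x :: "(nat list, 'a::chilbert_space) ell2"
  assumes a: "a \<in> {1..n}" and S: "S = orth_complement_in (fock n) (off_axis n a)"
  shows "orth_proj S x \<in> S" "coord (orth_proj S x) (replicate k a) = coord x (replicate k a)"
    "norm (orth_proj S x) \<le> norm x"
proof -
  define g where "g \<mu> = (if \<mu> \<in> range (\<lambda>p. replicate p a) then coord x \<mu> else 0)" for \<mu>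
  define y where "y = Abs_ell2 g"
  have "(\<lambda>\<mu>. (norm (g \<mu>))\<^sup>2) summable_on UNIV"
    by (rule summable_on_comparison_test[OF square_summable_coord[of x]]) (auto simp: g_def)
  then have y: "coord y = g" by (simp add: y_def Abs_ell2_inverse)
  have yS: "y \<in> S" by (simp add: S axis_coord[OF a] y g_def)
  have orth: "cinner s (x - y) = 0" if "s \<in> S" for s
    unfolding cinner_ell2_def
  proof (rule infsum_0)
    show "cinner (coord s \<mu>) (coord (x - y) \<mu>) = 0" for \<mu>
      using that by (cases "\<mu> \<in> range (\<lambda>p. replicate p a)")
        (auto simp: S axis_coord[OF a] minus_ell2.rep_eq y g_def)
  qed
  have eq: "orth_proj S x = y"
    unfolding orth_proj_def
  proof (rule the_equality)
    show "y \<in> S \<and> (\<forall>s\<in>S. cinner s (x - y) = 0)" using yS orth by blast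
    fix y' assume y': "y' \<in> S \<and> (\<forall>s\<in>S. cinner s (x - y') = 0)"
    then have "cinner s (y' - y) = 0" if "s \<in> S" for s
      using that orth[OF that] by (simp add: cinner_diff_right)
    then have "cinner (y' - y) (y' - y) = 0"
      using y' yS orth_complement_in_fock_diff unfolding S by blast
    then show "y' = y" by (simp add: cinner_self)
  qed
  show "orth_proj S x \<in> S" "coord (orth_proj S x) (replicate k a) = coord x (replicate k a)"
    using yS by (auto simp: eq y g_def)
  \<comment> \<open>Contractivity: orthogonality gives \<open>cinner y x\<close> the value of the
    squared norm of \<open>y\<close>, and Cauchy-Schwarz bounds it.\<close>
  have "cinner y x = cinner y y" using orth[OF yS] by (simp add: cinner_diff_right)
  then have "(norm y)\<^sup>2 = cmod (cinner y x)" by (simp add: cinner_self norm_power)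
  also have "\<dots> \<le> norm y * norm x" by (rule cmod_cinner_le)
  finally show "norm (orth_proj S x) \<le> norm x"
    unfolding eq by (cases "y = 0") (simp_all add: power2_eq_square)
qed

lemma norm_unitary_on: "unitary_on A B U \<Longrightarrow> x \<in> A \<Longrightarrow> norm (U x) = norm x"
  using cinner_self[of "U x"] cinner_self[of x]
  by (simp add: unitary_on_def flip: of_real_power)

text \<open>This is the source of the Toeplitz structure: carrying past \<open>p\<close> letters
  \<open>n\<close> only prepends \<open>p\<close> letters 1 to \<open>L \<eta>\<close>.\<close>

lemma coord_odometer_axis:
  assumes "is_odometer_map n L W"
  shows "coord (W (tens (ket (replicate p n)) \<eta>)) (replicate k 1)
    = (if k < p then 0 else coord (L \<eta>) (replicate (k - p) 1))"
proof -
  have "W (tens (ket (replicate p n)) \<eta>) = left_tensor (replicate p 1) (L \<eta>)"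
  proof (cases p)
    \<comment> \<open>The vacuum clause fits the same formula, since left tensoring by the empty
      word is the identity.\<close>
    case 0
    then show ?thesis
      using assms by (auto simp: is_odometer_map_def left_tensor.rep_eq intro: ell2_eqI)
  next
    case (Suc m)
    then have "p \<ge> 1" by simp
    then show ?thesis using assms unfolding is_odometer_map_def by blast
  qed
  \<comment> \<open>The word of \<open>k\<close> ones begins with \<open>p\<close> ones exactly when
    \<open>p \<le> k\<close>; otherwise the lengths differ.\<close>
  then show ?thesis
    by (auto simp: left_tensor.rep_eq min_def dest: arg_cong[of _ _ length])
qed


theorem theorem3p6:
  fixes n :: nat
    and L :: "'e::chilbert_space \<Rightarrow> (nat list, 'e) ell2"
    and W :: "(nat list, 'e) ell2 \<Rightarrow> (nat list, 'e) ell2"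
    and U\<^sub>1 U\<^sub>n :: "(nat list, 'e) ell2 \<Rightarrow> 'e hardy"
  assumes "n \<ge> 1"
    and "separable_space (euclidean :: 'e topology)"
    and "bounded_clinear_on UNIV (fock n) L"
    and "is_odometer_map n L W"
    and "is_axis_unitary 1 (M_perp n) U\<^sub>1"
    and "is_axis_unitary n (N_perp n) U\<^sub>n"
  shows "\<exists>\<Theta>\<in>Hinf.
    (\<forall>f. hardy_fun (U\<^sub>1 (W22 n W (adjoint_on (N_perp n) U\<^sub>n f))) = mult_op \<Theta> f) \<and>
    (\<forall>z\<in>ball 0 1. (\<lambda>r. scale_blinfun (z ^ r) (symbol_coeff L r)) sums \<Theta> z) \<and>
    (\<forall>\<Theta>'\<in>Hinf.
      (\<forall>f. hardy_fun (U\<^sub>1 (W22 n W (adjoint_on (N_perp n) U\<^sub>n f))) = mult_op \<Theta>' f) \<longrightarrow> \<Theta>' = \<Theta>)"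
proof -
  define T where "T f = U\<^sub>1 (W22 n W (adjoint_on (N_perp n) U\<^sub>n f))" for f
  define V where "V = adjoint_on (N_perp n) U\<^sub>n"
  have axes: "1 \<in> {1..n}" "n \<in> {1..n}" using assms(1) by auto
  have un1: "unitary_on (M_perp n) UNIV U\<^sub>1" and unn: "unitary_on (N_perp n) UNIV U\<^sub>n"
    using assms(5,6) by (auto simp: is_axis_unitary_def)
  have W: "bounded_clinear_on (fock n) (fock n) W"
    using assms(4) by (simp add: is_odometer_map_def)
  have V: "V f \<in> N_perp n" "U\<^sub>n (V f) = f" for f
    using adjoint_on_unitary[OF unn] orth_complement_in_fock_diff
    unfolding V_def N_perp_def by blast+
  have V_coord: "coord (V f) (replicate k n) = coord (hardy_coeffs f) k" for f k
    using axis_unitary_coeffs[OF axes(2) N_perp_def assms(6) V(1)[of f]] by (simp add: V(2))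
  have V_off: "coord (V f) \<mu> = 0" if "\<mu> \<notin> range (\<lambda>p. replicate p n)" for f \<mu>
    using V(1)[of f] that unfolding N_perp_def axis_coord[OF axes(2)] by blast
  \<comment> \<open>An element of \<open>N_perp n\<close> is determined by its coordinates at the
    powers of the letter \<open>n\<close>. Linearity of \<open>V\<close> and its values on monomials
    follow by comparing these.\<close>
  have V_eqI: "V f = x" if "x \<in> N_perp n" "\<And>k. coord x (replicate k n) = coord (hardy_coeffs f) k" for f x
  proof (rule ell2_eqI)
    show "coord (V f) \<mu> = coord x \<mu>" for \<mu>
      using that V_off[of \<mu> f] unfolding N_perp_def axis_coord[OF axes(2)]
      by (cases "\<mu> \<in> range (\<lambda>p. replicate p n)") (auto simp: V_coord)
  qed
  have V_fock: "V f \<in> fock n" for f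
    using V(1)[of f] by (simp add: N_perp_def orth_complement_in_def)
  have V_lin: "V (f + g) = V f + V g" "V (s *\<^sub>C f) = s *\<^sub>C V f" for f g s
    using V_off unfolding N_perp_def
    by (auto intro!: V_eqI simp: N_perp_def axis_coord[OF axes(2)] plus_ell2.rep_eq scaleC_ell2.rep_eq
        hardy_coeffs_add hardy_coeffs_scaleC V_coord cvec.scale_zero_right)
  have V_norm: "norm (V f) = norm f" for f
    using norm_unitary_on[OF unn V(1)[of f]] by (simp add: V(2))
  have V_ket: "V (hardy_of (tens (ket p) \<eta>)) = tens (ket (replicate p n)) \<eta>" for p \<eta>
    by (rule V_eqI) (auto simp: N_perp_def axis_coord[OF axes(2)] coord_tens_ket dest: arg_cong[of _ _ length])
  \<comment> \<open>The projection leaves the coordinate at the \<open>k\<close>-th power of the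
    letter 1 unchanged, and \<open>U\<^sub>1\<close> makes it the \<open>k\<close>-th Taylor
    coefficient.\<close>
  have T_coord: "coord (hardy_coeffs (T f)) k = coord (W (V f)) (replicate k 1)" for f k
    unfolding T_def V_def W22_def
    by (rule trans[OF axis_unitary_coeffs[OF axes(1) M_perp_def assms(5)
          orth_proj_axis(1)[OF axes(1) M_perp_def]] orth_proj_axis(2)[OF axes(1) M_perp_def]])
  obtain K where K: "norm (W x) \<le> K * norm x" if "x \<in> fock n" for x
    using W unfolding bounded_clinear_on_def by blast
  have W_lin: "W (x + y) = W x + W y" "W (s *\<^sub>C x) = s *\<^sub>C W x" if "x \<in> fock n" "y \<in> fock n" for x y s
    using W that by (auto simp: bounded_clinear_on_def)
  have "bounded_clinear_on UNIV UNIV T"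
    unfolding bounded_clinear_on_def
  proof (intro conjI ballI allI)
    show "T (f + g) = T f + T g" "T (s *\<^sub>C f) = s *\<^sub>C T f" for f g s
      by (simp_all add: hardy_coeffs_inject[symmetric] hardy_coeffs_add hardy_coeffs_scaleC)
        (auto intro!: ell2_eqI simp: T_coord V_lin W_lin[OF V_fock V_fock] plus_ell2.rep_eq scaleC_ell2.rep_eq)
    \<comment> \<open>Both unitaries are isometric and the projection is contractive, so the bound
      of \<open>W\<close> on the Fock space carries over.\<close>
    have "norm (T f) \<le> K * norm f" for f
    proof -
      have "norm (T f) = norm (orth_proj (M_perp n) (W (V f)))"
        using norm_unitary_on[OF un1 orth_proj_axis(1)[OF axes(1) M_perp_def]]
        by (simp add: T_def V_def W22_def)
      also have "\<dots> \<le> norm (W (V f))" by (rule orth_proj_axis(3)[OF axes(1) M_perp_def])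
      also have "\<dots> \<le> K * norm f" using K[OF V_fock[of f]] by (simp add: V_norm)
      finally show ?thesis .
    qed
    then show "\<exists>K. \<forall>f\<in>UNIV. norm (T f) \<le> K * norm f" by blast
  qed simp
  then obtain \<Theta> where \<Theta>: "\<Theta> \<in> Hinf" "\<And>f. hardy_fun (T f) = mult_op \<Theta> f"
    "\<And>z. z \<in> ball 0 1 \<Longrightarrow> (\<lambda>r. scale_blinfun (z ^ r) (symbol_coeff L r)) sums \<Theta> z"
  proof (rule toeplitz_operator_symbol)
    show "symbol_coeff L r \<in> clinear_blinfuns" for r by (rule symbol_coeff_clinear[OF assms(3)])
    show "coord (hardy_coeffs (T (hardy_of (tens (ket p) \<eta>)))) k
        = (if k < p then 0 else blinfun_apply (symbol_coeff L (k - p)) \<eta>)" for p \<eta> k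
      unfolding T_coord V_ket coord_odometer_axis[OF assms(4)] symbol_coeff_apply[OF assms(3)]
        bra_tensor_id_ket by (rule refl)
  qed blast
  \<comment> \<open>Any other symbol in \<open>Hinf\<close> gives the same multiplication operator,
    and that operator determines the symbol.\<close>
  have "\<Theta>' = \<Theta>" if "\<Theta>' \<in> Hinf" "\<forall>f. hardy_fun (T f) = mult_op \<Theta>' f" for \<Theta>'
    using that \<Theta>(2) by (intro mult_op_inj[OF that(1) \<Theta>(1)]) metis
  then show ?thesis
    using \<Theta> unfolding T_def by blast
qed

end
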